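(* For integers $k\ge 1$ and $n\ge 0$ let $A_{k,n}(q)$ be the rank generating function of $\hbox{Le}$-diagrams described in the context (with $A_{k,n}(q)=0$ for $n<k$). Set $A_k(q,x)=\sum_{n\ge 0}A_{k,n}(q)x^n$ and $A(q,x,y)=\sum_{k\ge1}\sum_{n\ge0}A_{k,n}(q)x^ny^k$. Then \[ A(q,x,y)=\frac{-y}{q(1-x)}+\sum_{i\ge1}\frac{y^i\,(q^{2i+1}-y)}{q^{i^2+i+1}\,\bigl(q^i-q^i[i+1]x+[i]xy\bigr)}, \] for every $k\ge1$ \[ A_k(q,x)=\sum_{i=0}^{k-1}(-1)^{i+k}\frac{x^{k-i-1}[i]^{k-i-1}}{q^{ki+i+1}(1-[i+1]x)^{k-i}}+\sum_{i=0}^{k}(-1)^{i+k}\frac{x^{k-i}[i]^{k-i}}{q^{ki}(1-[i+1]x)^{k-i+1}}, \] and for every $k\ge 1$, $n\ge0$, \[ A_{k,n}(q)=q^{-k^2}\sum_{i=0}^{k-1}(-1)^i\binom{n}{i}\Bigl(q^{ki}[k-i]^i[k-i+1]^{n-i}-q^{(k+1)i}[k-i-1]^i[k-i]^{n-i}\Bigr) =\sum_{i=0}^{k-1}\binom{n}{i}q^{-(k-i)^2}\Bigl([i-k]^i[k-i+1]^{n-i}-[i-k+1]^i[k-i]^{n-i}\Bigr). \]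
   Context: For an integer $m$ let $[m]=\frac{1-q^m}{1-q}$; so $[m]=1+q+\dots+q^{m-1}$ for $m\ge0$ (with $[0]=0$) and $[-m]=-q^{-m}[m]$. The convention $0^0=1$ is used. Fix $0\le k\le n$. A $\hbox{Le}$-diagram in a $k\times(n-k)$ rectangle is a pair $(\lambda,D)$ where $\lambda=(\lambda_1\ge\lambda_2\ge\dots\ge\lambda_k\ge0)$ is a partition with $\lambda_1\le n-k$, whose Young diagram $Y_\lambda$ has $\lambda_i$ left-justified boxes in row $i$ (row 1 on top), and $D:Y_\lambda\to\{0,1\}$ is a filling with the $\hbox{Le}$-property: there is no box filled with $0$ that has a box filled with $1$ somewhere above it in the same column and a box filled with $1$ somewhere to its left in the same row. The rank of $(\lambda,D)$ is the number of $1$'s in $D$. $A_{k,n}(q)=\sum q^{\mathrm{rank}(\lambda,D)}$ over all such diagrams. (By a theorem of Postnikov, the coefficient of $q^r$ in $A_{k,n}(q)$ is the number of $r$-dimensional cells in the cell decomposition of the totally nonnegative Grassmannian $Gr^+_{k,n}$ obtained by specifying which maximal minors are positive and which vanish.) All generating functions are elements of $\mathbb{Z}[q,q^{-1}][[x,y]]$; each factor $1/(q^i-q^i[i+1]x+[i]xy)$ and $1/(1-[i+1]x)$ denotes the inverse in this ring (its constant term in $x,y$ is invertible). *)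

theory Defs
  imports "HOL-Computational_Algebra.Formal_Power_Series"
begin

text \<open>q-integers [m] = (1 - q^m)/(1 - q), written so that they make sense for q = 1 too:
  [m] = 1 + q + ... + q^(m-1) for m \<ge> 0, and [-m] = - q^(-m) [m].\<close>
definition qint :: "'a::field \<Rightarrow> int \<Rightarrow> 'a" where
  "qint q m = (if 0 \<le> m then (\<Sum>j<nat m. q ^ j)
               else - inverse (q ^ nat (- m)) * (\<Sum>j<nat (- m). q ^ j))"

definition young :: "nat \<Rightarrow> (nat \<Rightarrow> nat) \<Rightarrow> (nat \<times> nat) set" where
  "young k lam = {(i, j). 1 \<le> i \<and> i \<le> k \<and> 1 \<le> j \<and> j \<le> lam i}"

definition partition_in_box :: "nat \<Rightarrow> nat \<Rightarrow> (nat \<Rightarrow> nat) \<Rightarrow> bool" where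
  "partition_in_box k n lam \<longleftrightarrow>
     (\<forall>i. (i = 0 \<or> k < i) \<longrightarrow> lam i = 0) \<and>
     (\<forall>i j. 1 \<le> i \<and> i \<le> j \<and> j \<le> k \<longrightarrow> lam j \<le> lam i) \<and>
     (\<forall>i. lam i \<le> n - k)"

text \<open>A filling D : Y \<rightarrow> {0,1} is encoded by the set of boxes filled with 1.
  Le-property: no box filled with 0 has a 1 above it in its column and a 1 to its left in its row.\<close>
definition le_property :: "(nat \<times> nat) set \<Rightarrow> (nat \<times> nat) set \<Rightarrow> bool" where
  "le_property Y D \<longleftrightarrow>
     (\<nexists>i j. (i, j) \<in> Y - D \<and> (\<exists>i'<i. (i', j) \<in> D) \<and> (\<exists>j'<j. (i, j') \<in> D))"

definition le_diagrams :: "nat \<Rightarrow> nat \<Rightarrow> ((nat \<Rightarrow> nat) \<times> (nat \<times> nat) set) set" where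
  "le_diagrams k n = {(lam, D). partition_in_box k n lam \<and> D \<subseteq> young k lam \<and>
                                 le_property (young k lam) D}"

definition Acoef :: "'a::field \<Rightarrow> nat \<Rightarrow> nat \<Rightarrow> 'a" where
  "Acoef q k n = (if n < k then 0 else (\<Sum>(lam, D)\<in>le_diagrams k n. q ^ card D))"

definition Aser_k :: "'a::field \<Rightarrow> nat \<Rightarrow> 'a fps" where
  "Aser_k q k = Abs_fps (\<lambda>n. Acoef q k n)"

text \<open>Bivariate series in x,y are modelled as ('a fps) fps: outer variable y, inner variable x.\<close>
definition Aser :: "'a::field \<Rightarrow> 'a fps fps" where
  "Aser q = Abs_fps (\<lambda>k. if k = 0 then 0 else Aser_k q k)"

abbreviation fX :: "'a::field fps fps" where "fX \<equiv> fps_const fps_X"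
abbreviation fY :: "'a::field fps fps" where "fY \<equiv> fps_X"
abbreviation fC :: "'a::field \<Rightarrow> 'a fps fps" where "fC c \<equiv> fps_const (fps_const c)"

end

theory Submission
  imports Defs
begin

text \<open>
  Remove the bottom row of a Le-diagram. If its 1's form the set R, then every 0 of that row to the
  right of the first 1 forces its whole column above to be zero, and there is no other constraint.
  Hence only the number of columns forced to be zero matters, and writing a polynomial in
  t = [j+1] as a function of j, adding a row of length m and prolonging the rows by a column act by
  D f(j) = q^(-j) ([j+1] f(j+1) - [j] f(j)) and E f(j) = [j+1] f(j). Consequently
  the sum over k of A_{k,n} y^k is ((E + y D)^n 1)(0).

  The operator E + y D is upper bidiagonal with eigenvalues [i+1] + y [-i]. Expanding the constant
  function 1 into its eigenvectors gives the coefficient y^i (q^(2i+1) - y) / q^((i+1)^2) of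
  ([i+1] + y [-i])^n at j = 0, and all the formulas are coefficient extractions from this expansion.
  The infinite expansion is truncated modulo powers of y.
\<close>

unbundle fps_syntax

section \<open>Spectral decomposition of the transfer operator\<close>

text \<open>\<open>qint\<close> needs a field; this version for natural indices lives in any
  commutative ring and can be evaluated at a constant power series.\<close>

definition qnum :: "'a::comm_ring_1 \<Rightarrow> nat \<Rightarrow> 'a" where
  "qnum q n = (\<Sum>j<n. q ^ j)"

lemma qnum_0 [simp]: "qnum q 0 = 0"
  and qnum_1 [simp]: "qnum q (Suc 0) = 1"
  by (simp_all add: qnum_def)

lemma qnum_Suc: "qnum q (Suc n) = qnum q n + q ^ n"
  by (simp add: qnum_def)

lemma qnum_Suc': "qnum q (Suc n) = 1 + q * qnum q n"
proof (induction n)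
  case (Suc n)
  have "qnum q (Suc (Suc n)) = 1 + q * (qnum q n + q ^ n)"
    unfolding qnum_Suc[of q "Suc n"] Suc.IH by (simp add: algebra_simps)
  thus ?case unfolding qnum_Suc[of q n] .
qed simp

lemma qnum_add: "qnum q (m + n) = qnum q m + q ^ m * qnum q n"
  by (induction n) (simp_all add: qnum_Suc power_add algebra_simps)

text \<open>Gaussian binomial coefficients, given by the Pascal rule because no division is
  available in a commutative ring.\<close>

fun qbin :: "'a::comm_ring_1 \<Rightarrow> nat \<Rightarrow> nat \<Rightarrow> 'a" where
  "qbin q n 0 = 1"
| "qbin q 0 (Suc k) = 0"
| "qbin q (Suc n) (Suc k) = qbin q n k + q ^ Suc k * qbin q n (Suc k)"

lemma qbin_eq_0: "n < k \<Longrightarrow> qbin q n k = 0"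
  by (induction q n k rule: qbin.induct) auto

text \<open>Since [i] - [j] = q^j [i-j] for j <= i, this is the absorption rule for Gaussian
  binomials. The form with a difference also holds for i < j, where both binomials vanish.\<close>

lemma qbin_absorb:
  "(qnum q i - qnum q j) * qbin q i j = q ^ j * qnum q (Suc j) * qbin q i (Suc j)"
proof (induction i arbitrary: j)
  case 0
  show ?case by (cases j) auto
next
  case (Suc i)
  show ?case
  proof (cases j)
    case 0
    with Suc[of 0] show ?thesis by (simp add: qnum_Suc' algebra_simps)
  next
    case (Suc j')
    let ?a = "qnum q i" and ?b = "qnum q j'" and ?B = "qbin q i"
    have 1: "(?a - ?b) * ?B j' = q ^ j' * qnum q (Suc j') * ?B (Suc j')"
      by (rule Suc.IH)
    have 2: "(?a - qnum q (Suc j')) * ?B (Suc j') = q ^ Suc j' * qnum q (Suc (Suc j')) * ?B (Suc (Suc j'))"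
      by (rule Suc.IH)
    have "(qnum q (Suc i) - qnum q (Suc j')) * (?B j' + q ^ Suc j' * ?B (Suc j'))
        = q * ((?a - ?b) * ?B j') + q * q ^ Suc j' * (?a - ?b) * ?B (Suc j')"
      unfolding qnum_Suc' by (simp add: algebra_simps)
    also have "\<dots> = q ^ Suc j' * ((qnum q (Suc j') + q * (?a - ?b)) * ?B (Suc j'))"
      unfolding 1 by (simp add: algebra_simps)
    also have "qnum q (Suc j') + q * (?a - ?b) = qnum q (Suc (Suc j')) + q * (?a - qnum q (Suc j'))"
      unfolding qnum_Suc' by (simp add: algebra_simps)
    also have "q ^ Suc j' * ((qnum q (Suc (Suc j')) + q * (?a - qnum q (Suc j'))) * ?B (Suc j'))
      = q ^ Suc j' * (qnum q (Suc (Suc j')) * ?B (Suc j') + q * ((?a - qnum q (Suc j')) * ?B (Suc j')))"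
      by (simp add: algebra_simps)
    also have "\<dots> = q ^ Suc j' * qnum q (Suc (Suc j')) * (?B (Suc j') + q ^ Suc (Suc j') * ?B (Suc (Suc j')))"
      unfolding 2 by (simp add: algebra_simps)
    finally show ?thesis unfolding Suc by simp
  qed
qed

lemma qnum_geometric: "(1 - q) * qnum q n = 1 - q ^ n"
  using qnum_Suc[of q n] qnum_Suc'[of q n] by (simp add: algebra_simps)

text \<open>The second Pascal rule, times \<open>q ^ j\<close>. Multiplying
  \<open>qbin_absorb\<close> by 1 - q turns [i] - [j] into q^j - q^i, which converts one rule into
  the other.\<close>

lemma qbin_Suc_Suc':
  "q ^ j * qbin q (Suc i) (Suc j) = q ^ i * qbin q i j + q ^ j * qbin q i (Suc j)"
proof -
  have "(q ^ j - q ^ i) * qbin q i j = (1 - q) * ((qnum q i - qnum q j) * qbin q i j)"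
    unfolding mult.assoc[symmetric] right_diff_distrib qnum_geometric by simp
  also have "\<dots> = q ^ j * ((1 - q) * qnum q (Suc j)) * qbin q i (Suc j)"
    unfolding qbin_absorb by (simp add: algebra_simps)
  also have "\<dots> = q ^ j * (1 - q ^ Suc j) * qbin q i (Suc j)"
    unfolding qnum_geometric ..
  finally show ?thesis by (simp add: algebra_simps)
qed

section \<open>Eigenvalues and eigenvectors of the transfer operator\<close>

text \<open>Here and below \<open>p\<close> stands for the inverse of \<open>q\<close>; working in a commutative ring allows
  \<open>q\<close>, \<open>p\<close> and \<open>y\<close> to be instantiated by power series.\<close>

definition eigval :: "'a::comm_ring_1 \<Rightarrow> 'a \<Rightarrow> 'a \<Rightarrow> nat \<Rightarrow> 'a" where
  "eigval q p y i = qnum q (Suc i) - y * p ^ i * qnum q i"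

text \<open>For fixed \<open>i\<close> this is an eigenvector in the variable \<open>j\<close>. The
  product solves the two-term recurrence of a bidiagonal operator, and the factors free of
  \<open>j\<close> scale it so that the sum over \<open>i\<close> is 1 in the y-adic sense. It
  vanishes for j > i through \<open>qbin\<close>, so the truncated exponent \<open>i - j\<close>
  does no harm.\<close>

definition eigcoef :: "'a::comm_ring_1 \<Rightarrow> 'a \<Rightarrow> 'a \<Rightarrow> nat \<Rightarrow> nat \<Rightarrow> 'a" where
  "eigcoef q p y i j = y ^ (i - j) * (q ^ (2 * i + 1) - y) * p ^ ((i + 1)\<^sup>2) * qbin q i j
     * (\<Prod>l<j. q ^ l * (q ^ Suc l - y * p ^ i))"

text \<open>The operator \<open>E + y D\<close> of the overview, with all terms in
  \<open>F j\<close> collected into \<open>eigval\<close>.\<close>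

definition transfer :: "'a::comm_ring_1 \<Rightarrow> 'a \<Rightarrow> 'a \<Rightarrow> (nat \<Rightarrow> 'a) \<Rightarrow> nat \<Rightarrow> 'a" where
  "transfer q p y F j = eigval q p y j * F j + y * p ^ j * qnum q (Suc j) * F (Suc j)"

text \<open>Both [i] + q^i [j] and [j] + q^j [i] equal [i+j]; this symmetry lets [i] - [j] be
  factored out. That factor feeds \<open>qbin_absorb\<close>, while
  \<open>q ^ Suc j - y * p ^ i\<close> extends the product in \<open>eigcoef\<close>.\<close>

lemma eigval_diff:
  assumes pq: "p * q = 1"
  shows "eigval q p y i - eigval q p y j = (qnum q i - qnum q j) * (p ^ j * (q ^ Suc j - y * p ^ i))"
proof -
  have inv: "p ^ n * q ^ n = 1" for n
    using pq by (simp flip: power_mult_distrib)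
  have "qnum q i + q ^ i * qnum q j = qnum q j + q ^ j * qnum q i"
    by (metis add.commute qnum_add)
  hence sym: "qnum q i - qnum q j = q ^ j * qnum q i - q ^ i * qnum q j"
    by (simp add: algebra_simps)
  have "(qnum q i - qnum q j) * (p ^ j * (q ^ Suc j - y * p ^ i))
      = q * (p ^ j * q ^ j) * (qnum q i - qnum q j) - y * p ^ i * p ^ j * (qnum q i - qnum q j)"
    by (simp add: algebra_simps)
  also have "y * p ^ i * p ^ j * (qnum q i - qnum q j)
      = y * p ^ i * (p ^ j * q ^ j) * qnum q i - y * p ^ j * (p ^ i * q ^ i) * qnum q j"
    unfolding sym by (simp add: algebra_simps)
  finally show ?thesis
    by (simp add: inv eigval_def qnum_Suc' algebra_simps)
qed

lemma eigcoef_transfer: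
  assumes pq: "p * q = 1"
  shows "transfer q p y (eigcoef q p y i) j = eigval q p y i * eigcoef q p y i j"
proof -
  define P where "P = (\<Prod>l<j. q ^ l * (q ^ Suc l - y * p ^ i))"
  define K where "K = (q ^ (2 * i + 1) - y) * p ^ ((i + 1)\<^sup>2)"
  \<comment> \<open>For j >= i the truncated exponents would not match, but then both sides are
    0.\<close>
  have ab: "y ^ (i - j) * ((qnum q i - qnum q j) * qbin q i j)
          = y * y ^ (i - Suc j) * (q ^ j * qnum q (Suc j) * qbin q i (Suc j))"
  proof (cases "j < i")
    case True
    hence "i - j = Suc (i - Suc j)" by simp
    thus ?thesis unfolding qbin_absorb by simp
  qed (simp add: qbin_absorb qbin_eq_0)
  have "(eigval q p y i - eigval q p y j) * eigcoef q p y i j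
      = K * P * (p ^ j * (q ^ Suc j - y * p ^ i)) * (y ^ (i - j) * ((qnum q i - qnum q j) * qbin q i j))"
    unfolding eigval_diff[OF pq] eigcoef_def K_def P_def by (simp only: mult_ac)
  also have "\<dots> = y * p ^ j * qnum q (Suc j) * eigcoef q p y i (Suc j)"
    unfolding ab eigcoef_def prod.lessThan_Suc P_def[symmetric] K_def by (simp only: mult_ac)
  finally show ?thesis
    by (simp add: transfer_def algebra_simps)
qed

text \<open>The antidifference, in \<open>i\<close>, of the difference of \<open>eigcoef\<close> in \<open>j\<close>. It is what makes
  the column sums of \<open>eigcoef\<close> independent of \<open>j\<close>.\<close>

definition eigtel :: "'a::comm_ring_1 \<Rightarrow> 'a \<Rightarrow> 'a \<Rightarrow> nat \<Rightarrow> nat \<Rightarrow> 'a" where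
  "eigtel q p y i j = y ^ (i - Suc j) * p ^ (i\<^sup>2) * qbin q i (Suc j)
     * (\<Prod>l<Suc j. q ^ l * (q ^ Suc l - y * q * p ^ i))"

text \<open>Taking a factor \<open>q\<close> out of each of the \<open>Suc j\<close> factors and
  shifting the index makes the product of \<open>eigtel\<close> comparable with that of
  \<open>eigcoef\<close>.\<close>

lemma prod_shift:
  fixes q :: "'a::comm_ring_1"
  shows "(\<Prod>l<Suc j. q ^ l * (q ^ Suc l - y * q * p ^ i))
     = q ^ j * q ^ Suc j * (1 - y * p ^ i) * (\<Prod>l<j. q ^ l * (q ^ Suc l - y * p ^ i))"
proof -
  have "(\<Prod>l<Suc j. q ^ l * (q ^ Suc l - y * q * p ^ i))
      = (\<Prod>l<Suc j. q ^ l) * (q ^ Suc j * (\<Prod>l<Suc j. q ^ l - y * p ^ i))"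
  proof -
    have "q ^ Suc j = (\<Prod>l<Suc j. q)" by simp
    moreover have "q ^ l * (q ^ Suc l - y * q * p ^ i) = q ^ l * (q * (q ^ l - y * p ^ i))" for l
      by (simp add: algebra_simps)
    ultimately show ?thesis
      by (simp only: prod.distrib)
  qed
  also have "(\<Prod>l<Suc j. q ^ l - y * p ^ i) = (1 - y * p ^ i) * (\<Prod>l<j. q ^ Suc l - y * p ^ i)"
    by (subst prod.lessThan_Suc_shift) simp
  finally show ?thesis
    by (simp only: prod.distrib prod.lessThan_Suc mult_ac)
qed

text \<open>For j < i all four terms share the factor \<open>Y * u * P\<close>, and an identity in
  q^i, q^j and two neighbouring Gaussian binomials remains. For i = j only two terms survive, and
  for i < j none.\<close>

lemma eigcoef_telescope:
  assumes pq: "p * q = 1"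
  shows "eigcoef q p y i (Suc j) - eigcoef q p y i j = eigtel q p y i j - eigtel q p y (Suc i) j"
proof -
  define P where "P = (\<Prod>l<j. q ^ l * (q ^ Suc l - y * p ^ i))"
  define u where "u = p ^ ((i + 1)\<^sup>2)"
  define v where "v = p ^ i"
  define B where "B = qbin q i j"
  define B' where "B' = qbin q i (Suc j)"
  have inv: "p ^ n * q ^ n = 1" for n
    using pq by (simp flip: power_mult_distrib)
  have uq: "p ^ (i\<^sup>2) = u * q ^ (2 * i + 1)"
  proof -
    have "(i + 1)\<^sup>2 = i\<^sup>2 + (2 * i + 1)" by (simp add: power2_eq_square)
    hence "u * q ^ (2 * i + 1) = p ^ (i\<^sup>2) * (p ^ (2 * i + 1) * q ^ (2 * i + 1))"
      unfolding u_def by (simp only: power_add[of p "i\<^sup>2"] mult.assoc)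
    thus ?thesis unfolding inv by simp
  qed
  \<comment> \<open>Both sides compute q^j times \<open>qbin q (Suc i) (Suc j)\<close>, by the two
    Pascal rules.\<close>
  have pas: "q ^ i * B + q ^ j * B' = q ^ j * B + q ^ j * q ^ Suc j * B'"
    using qbin_Suc_Suc'[of q j i] by (simp add: B_def B'_def algebra_simps)
  show ?thesis
  proof (cases "j < i")
    case True
    define Y where "Y = y ^ (i - Suc j)"
    have Y: "y ^ (i - j) = y * Y" "y ^ (Suc i - Suc j) = y * Y"
      using True by (simp_all add: Y_def Suc_diff_Suc flip: power_Suc)
    have vq: "v * q ^ i = 1" by (simp add: v_def inv)
    have P1: "(\<Prod>l<Suc j. q ^ l * (q ^ Suc l - y * p ^ i)) = P * (q ^ j * (q ^ Suc j - y * v))"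
      by (simp add: P_def v_def)
    have P2: "(\<Prod>l<Suc j. q ^ l * (q ^ Suc l - y * q * p ^ Suc i)) = P * (q ^ j * (q ^ Suc j - y * v))"
    proof -
      have "y * q * p ^ Suc i = y * p ^ i"
        using arg_cong[OF pq, of "\<lambda>x. y * x * p ^ i"] by (simp add: mult_ac)
      thus ?thesis unfolding P1[symmetric] by simp
    qed
    have P3: "(\<Prod>l<Suc j. q ^ l * (q ^ Suc l - y * q * p ^ i)) = q ^ j * q ^ Suc j * (1 - y * v) * P"
      unfolding prod_shift P_def v_def ..
    have e1: "eigcoef q p y i (Suc j) = Y * u * P * ((q ^ (2 * i + 1) - y) * B' * (q ^ j * (q ^ Suc j - y * v)))"
      unfolding eigcoef_def P1 Y_def[symmetric] u_def[symmetric] B'_def by (simp only: mult_ac)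
    have e2: "eigcoef q p y i j = Y * u * P * (y * (q ^ (2 * i + 1) - y) * B)"
      unfolding eigcoef_def P_def[symmetric] Y u_def[symmetric] B_def by (simp only: mult_ac)
    have e3: "eigtel q p y i j = Y * u * P * (q ^ (2 * i + 1) * B' * (q ^ j * q ^ Suc j * (1 - y * v)))"
      unfolding eigtel_def P3 Y_def[symmetric] uq B'_def by (simp only: mult_ac)
    have e4: "eigtel q p y (Suc i) j = Y * u * P * (y * (B + q ^ Suc j * B') * (q ^ j * (q ^ Suc j - y * v)))"
      unfolding eigtel_def P2 Y qbin.simps B'_def B_def u_def Suc_eq_plus1[of i, symmetric] by (simp only: mult_ac)
    define Q where "Q = q ^ i"
    define J where "J = q ^ j"
    have q2: "q ^ (2 * i + 1) = q * Q * Q" by (simp add: Q_def mult_2 power_add)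
    have vQ: "v * Q = 1" using vq by (simp add: Q_def)
    have pas': "Q * B + J * B' = J * B + J * (q * J) * B'"
      using pas by (simp add: Q_def J_def)
    have qJ: "q ^ Suc j = q * J" by (simp add: J_def)
    have "(q * Q * Q - y) * B' * (J * (q * J - y * v)) - y * (q * Q * Q - y) * B
        = q * Q * Q * B' * (J * (q * J) * (1 - y * v)) - y * (B + q * J * B') * (J * (q * J - y * v))"
      (is "?L = ?R")
    proof -
      \<comment> \<open>The cofactors exhibit the difference as a combination of the relations
        \<open>pas'\<close> and \<open>v * Q = 1\<close>, leaving a plain ring identity.\<close>
      have "?L - ?R = (Q * B + J * B' - (J * B + J * (q * J) * B')) * (y * y * v - y * q * (Q + J))
          + (v * Q - 1) * (y * q * Q * J * B' * (q * J - 1) - y * y * B)"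
        by (simp add: algebra_simps)
      thus ?thesis unfolding vQ pas' by simp
    qed
    thus ?thesis
      unfolding e1 e2 e3 e4 q2 qJ J_def[symmetric] by (simp only: right_diff_distrib[symmetric])
  next
    case False
    show ?thesis
    proof (cases "i = j")
      case True
      have "y * q * p ^ Suc i = y * p ^ i"
        using arg_cong[OF pq, of "\<lambda>x. y * x * p ^ i"] by (simp add: mult_ac)
      hence P2: "(\<Prod>l<Suc j. q ^ l * (q ^ Suc l - y * q * p ^ Suc i)) = P * (q ^ j * (q ^ Suc j - y * p ^ i))"
        by (simp add: P_def)
      \<comment> \<open>On the diagonal the last product factor of \<open>eigtel\<close> at
        \<open>Suc i\<close> has to become the factor \<open>q ^ (2 * i + 1) - y\<close> of
        \<open>eigcoef\<close>.\<close>
      have "2 * j + 1 = j + Suc j" by simp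
      hence "q ^ (2 * j + 1) = q ^ j * q ^ Suc j" by (simp only: power_add)
      hence "q ^ j * (q ^ Suc j - y * p ^ j) = q ^ (2 * j + 1) - y * (p ^ j * q ^ j)"
        by (simp only: right_diff_distrib mult_ac)
      hence 1: "q ^ j * (q ^ Suc j - y * p ^ j) = q ^ (2 * j + 1) - y" by (simp add: inv)
      show ?thesis
        unfolding eigcoef_def eigtel_def True P2[unfolded True 1 P_def]
        by (simp add: qbin_eq_0 del: power_Suc)
    qed (use False in \<open>simp add: eigcoef_def eigtel_def qbin_eq_0\<close>)
  qed
qed

section \<open>Expansion of the constant function 1 into eigenvectors\<close>

text \<open>The exponents of \<open>p\<close> differ by 2 i + 1, so the entries at 0 telescope in
  \<open>i\<close>. The two terms are also the source of the two sums in the final formulas.\<close>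

lemma eigcoef_0:
  assumes pq: "p * q = 1"
  shows "eigcoef q p y i 0 = y ^ i * p ^ (i\<^sup>2) - y ^ Suc i * p ^ ((Suc i)\<^sup>2)"
proof -
  have "(Suc i)\<^sup>2 = i\<^sup>2 + (2 * i + 1)" by (simp add: power2_eq_square)
  moreover have "p ^ (2 * i + 1) * q ^ (2 * i + 1) = 1"
    unfolding power_mult_distrib[symmetric] pq by simp
  ultimately have "p ^ ((Suc i)\<^sup>2) * q ^ (2 * i + 1) = p ^ (i\<^sup>2)"
    by (simp only: power_add[of p "i\<^sup>2"] mult.assoc mult_1_right)
  hence "y ^ i * p ^ (i\<^sup>2) = y ^ i * (p ^ ((Suc i)\<^sup>2) * q ^ (2 * i + 1))" by simp
  thus ?thesis by (simp add: eigcoef_def algebra_simps)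
qed

text \<open>At j = 0 the sum telescopes with an error divisible by y^(N+1). Passing from
  \<open>j\<close> to \<open>Suc j\<close> adds the boundary term
  \<open>eigtel q p y (Suc N) j\<close>, which loses one power of y and so accounts for the
  modulus.\<close>

lemma sum_eigcoef:
  assumes pq: "p * q = 1"
  shows "y ^ (Suc N - j) dvd (\<Sum>i\<le>N. eigcoef q p y i j) - 1"
proof (induction j)
  case 0
  have "(\<Sum>i\<le>N. eigcoef q p y i 0) = 1 - y ^ Suc N * p ^ ((Suc N)\<^sup>2)"
    unfolding eigcoef_0[OF pq] by (subst sum_telescope) simp
  thus ?case by simp
next
  case (Suc j)
  have "(\<Sum>i\<le>N. eigcoef q p y i (Suc j)) - (\<Sum>i\<le>N. eigcoef q p y i j) = - eigtel q p y (Suc N) j"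
    unfolding sum_subtractf[symmetric] eigcoef_telescope[OF pq]
    \<comment> \<open>The lower end \<open>eigtel q p y 0 j\<close> of the telescope contains
      \<open>qbin q 0 (Suc j)\<close> and is 0.\<close>
    by (subst sum_telescope) (simp add: eigtel_def)
  hence "(\<Sum>i\<le>N. eigcoef q p y i (Suc j)) - 1 = ((\<Sum>i\<le>N. eigcoef q p y i j) - 1) - eigtel q p y (Suc N) j"
    by (simp add: algebra_simps)
  moreover have "y ^ (Suc N - Suc j) dvd eigtel q p y (Suc N) j"
    unfolding eigtel_def by simp
  moreover have "y ^ (Suc N - Suc j) dvd y ^ (Suc N - j)"
    by (rule le_imp_power_dvd) simp
  ultimately show ?case by (simp only: dvd_diff[OF dvd_trans[OF _ Suc.IH]])
qed

text \<open>Applying the operator multiplies each eigenvector by its eigenvalue. The precision at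
  \<open>Suc j\<close> is one order lower, but \<open>transfer\<close> reads that entry with a
  factor \<open>y\<close>, so the modulus survives every step.\<close>

lemma transfer_power_expansion:
  assumes pq: "p * q = 1"
  shows "y ^ (Suc N - j) dvd
    (\<Sum>i\<le>N. eigcoef q p y i j * eigval q p y i ^ n) - (transfer q p y ^^ n) (\<lambda>_. 1) j"
proof (induction n arbitrary: j)
  case 0
  show ?case using sum_eigcoef[OF pq] by simp
next
  case (Suc n)
  let ?S = "\<lambda>j. \<Sum>i\<le>N. eigcoef q p y i j * eigval q p y i ^ n"
  let ?T = "(transfer q p y ^^ n) (\<lambda>_. 1)"
  have "(\<Sum>i\<le>N. eigcoef q p y i j * eigval q p y i ^ Suc n)
      = (\<Sum>i\<le>N. transfer q p y (eigcoef q p y i) j * eigval q p y i ^ n)"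
    unfolding eigcoef_transfer[OF pq] by (simp add: mult_ac)
  also have "\<dots> = transfer q p y ?S j"
    by (simp add: transfer_def sum_distrib_left sum.distrib algebra_simps)
  finally have "(\<Sum>i\<le>N. eigcoef q p y i j * eigval q p y i ^ Suc n) - (transfer q p y ^^ Suc n) (\<lambda>_. 1) j
     = transfer q p y ?S j - transfer q p y ?T j" by simp
  also have "\<dots> = eigval q p y j * (?S j - ?T j) + p ^ j * qnum q (Suc j) * (y * (?S (Suc j) - ?T (Suc j)))"
    unfolding transfer_def by (simp add: algebra_simps)
  finally have *: "(\<Sum>i\<le>N. eigcoef q p y i j * eigval q p y i ^ Suc n) - (transfer q p y ^^ Suc n) (\<lambda>_. 1) j = \<dots>" .
  have "y ^ (Suc N - j) dvd y * y ^ (Suc N - Suc j)"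
    by (cases "j \<le> N") (simp_all add: Suc_diff_le)
  also have "\<dots> dvd y * (?S (Suc j) - ?T (Suc j))"
    by (intro mult_dvd_mono Suc.IH dvd_refl)
  finally have "y ^ (Suc N - j) dvd y * (?S (Suc j) - ?T (Suc j))" .
  with Suc.IH[of j] show ?case unfolding * by simp
qed

section \<open>Row removal in Le-diagrams\<close>

text \<open>If \<open>R\<close> is the set of 1's in the bottom row, chosen among the available columns \<open>A\<close>, the
  Le-property forces the columns in \<open>holes A R\<close> to vanish in all rows above, and nothing else.\<close>

definition holes :: "nat set \<Rightarrow> nat set \<Rightarrow> nat set" where
  "holes A R = {j \<in> A. j \<notin> R \<and> (\<exists>i\<in>R. i < j)}"

definition col_op :: "'a::field \<Rightarrow> (nat \<Rightarrow> 'a) \<Rightarrow> nat \<Rightarrow> 'a" where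
  "col_op q f j = qnum q (Suc j) * f j"

text \<open>As \<open>q ^ j\<close> is [j+1] - [j], this is a divided difference of the function [j]
  f(j).\<close>

definition row_op :: "'a::field \<Rightarrow> (nat \<Rightarrow> 'a) \<Rightarrow> nat \<Rightarrow> 'a" where
  "row_op q f j = inverse q ^ j * (qnum q (Suc j) * f (Suc j) - qnum q j * f j)"

section \<open>Contribution of a single row\<close>

text \<open>Columns are added from left to right. A new last column becomes a hole if it holds 0 and
  the row already contains a 1, stays free if the row is empty, and contributes a factor q t with t
  = [j+1] if it holds 1. This gives the recurrence S' = (1 + q t) S + t^(M+1) - t^M for the sum over
  \<open>M\<close> columns, which \<open>row_op\<close> also satisfies.\<close>

lemma sum_holes:
  fixes q :: "'a::field"
  assumes "q \<noteq> 0" and "finite A"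
  shows "(\<Sum>R\<in>Pow A. q ^ card R * qnum q (Suc j) ^ (card A - card (holes A R)))
       = row_op q (\<lambda>i. qnum q (Suc i) ^ card A) j"
  using assms(2)
proof (induction A rule: finite_linorder_max_induct)
  case empty
  show ?case using assms(1) by (simp add: row_op_def qnum_Suc field_simps)
next
  case (insert b A)
  define t where "t = qnum q (Suc j)"
  define M where "M = card A"
  define g where "g = (\<lambda>R. q ^ card R * t ^ (M - card (holes A R)))"
  have bA: "b \<notin> A" using insert.hyps by auto
  have cM: "card (insert b A) = Suc M" using bA insert.hyps by (simp add: M_def)
  have holes_le: "card (holes A R) \<le> M" for R
    unfolding M_def holes_def using insert.hyps by (intro card_mono) auto
  let ?f = "\<lambda>R. q ^ card R * t ^ (card (insert b A) - card (holes (insert b A) R))"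
  have f1: "?f R = g R + (if R = {} then t ^ Suc M - t ^ M else 0)" if R: "R \<subseteq> A" for R
  proof (cases "R = {}")
    case True
    thus ?thesis by (simp add: holes_def g_def cM)
  next
    case False
    hence "holes (insert b A) R = insert b (holes A R)"
      using R bA insert.hyps unfolding holes_def by blast
    moreover have "b \<notin> holes A R" "finite (holes A R)"
      using bA insert.hyps by (auto simp: holes_def)
    ultimately have "card (holes (insert b A) R) = Suc (card (holes A R))" by simp
    thus ?thesis using False by (simp add: cM g_def)
  qed
  have f2: "?f (insert b R) = q * t * g R" if R: "R \<subseteq> A" for R
  proof -
    have "holes (insert b A) (insert b R) = holes A R"
      using R bA insert.hyps unfolding holes_def by fastforce
    moreover have "card (insert b R) = Suc (card R)"
      using R bA insert.hyps by (meson card_insert_disjoint finite_subset subsetD)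
    ultimately show ?thesis using holes_le[of R] by (simp add: cM g_def Suc_diff_le)
  qed
  have inj: "inj_on (insert b) (Pow A)" using bA by (auto simp: inj_on_def)
  have "(\<Sum>R\<in>Pow (insert b A). ?f R) = (\<Sum>R\<in>Pow A. ?f R) + (\<Sum>R\<in>Pow A. ?f (insert b R))"
    unfolding Pow_insert using bA insert.hyps(1) inj
    by (subst sum.union_disjoint) (auto simp: sum.reindex)
  also have "\<dots> = (\<Sum>R\<in>Pow A. g R + (if R = {} then t ^ Suc M - t ^ M else 0)) + (\<Sum>R\<in>Pow A. q * t * g R)"
    by (intro arg_cong2[of _ _ _ _ "(+)"] sum.cong) (use f1 f2 in auto)
  also have "\<dots> = (1 + q * t) * (\<Sum>R\<in>Pow A. g R) + (t ^ Suc M - t ^ M)"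
    using insert.hyps(1) by (simp add: sum.distrib sum_distrib_left algebra_simps)
  also have "(\<Sum>R\<in>Pow A. g R) = row_op q (\<lambda>i. qnum q (Suc i) ^ M) j"
    using insert.IH by (simp add: g_def M_def t_def)
  also have "(1 + q * t) * row_op q (\<lambda>i. qnum q (Suc i) ^ M) j + (t ^ Suc M - t ^ M)
           = row_op q (\<lambda>i. qnum q (Suc i) ^ Suc M) j"
  proof -
    define t' where "t' = qnum q (Suc (Suc j))"
    define v where "v = inverse q ^ j"
    define s where "s = qnum q j"
    have 1: "t' = 1 + q * t" unfolding t_def t'_def by (rule qnum_Suc')
    have 2: "t = 1 + q * s" unfolding t_def s_def by (rule qnum_Suc')
    have "v * q ^ j = 1" using assms(1) by (simp add: v_def field_simps)
    moreover have "q ^ j = t - s" by (simp add: t_def s_def qnum_Suc)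
    ultimately have 3: "v * (t - s) = 1" by simp
    \<comment> \<open>Powers are replaced by arbitrary \<open>T\<close> and \<open>T'\<close>, since
      the recurrence already follows from the three polynomial relations.\<close>
    have "t' * (v * (t * T' - s * T)) + (t * T - T) = v * (t * (t' * T') - s * (t * T))" for T T'
      using 1 2 3 by algebra
    from this[of "t' ^ M" "t ^ M"] show ?thesis
      unfolding row_op_def t_def[symmetric] t'_def[symmetric] v_def[symmetric] s_def[symmetric] 1[symmetric]
      by simp
  qed
  finally show ?case unfolding cM t_def .
qed

text \<open>Sums over all products of \<open>k\<close> row operators and \<open>n - k\<close> column operators, i.e. over all
  lattice paths bounding a partition in the \<open>k\<close> by \<open>n - k\<close> box.\<close>

fun weight :: "'a::field \<Rightarrow> nat \<Rightarrow> nat \<Rightarrow> (nat \<Rightarrow> 'a) \<Rightarrow> 'a" where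
  "weight q 0 k f = (if k = 0 then f 0 else 0)"
| "weight q (Suc n) k f = weight q n k (col_op q f)
     + (if k = 0 then 0 else weight q n (k - 1) (row_op q f))"

lemma weight_eq_0: "n < k \<Longrightarrow> weight q n k f = 0"
  by (induction q n k f rule: weight.induct) auto

lemma weight_0_right: "weight q n 0 f = f 0"
  by (induction n arbitrary: f) (simp_all add: col_op_def)

lemma weight_sum:
  "weight q n k (\<lambda>j. \<Sum>R\<in>S. a R * f R j) = (\<Sum>R\<in>S. a R * weight q n k (f R))"
proof (induction n arbitrary: k f)
  case (Suc n)
  have 1: "col_op q (\<lambda>j. \<Sum>R\<in>S. a R * f R j) = (\<lambda>j. \<Sum>R\<in>S. a R * col_op q (f R) j)"
    by (simp add: fun_eq_iff col_op_def sum_distrib_left mult_ac)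
  have 2: "row_op q (\<lambda>j. \<Sum>R\<in>S. a R * f R j) = (\<lambda>j. \<Sum>R\<in>S. a R * row_op q (f R) j)"
    by (simp add: fun_eq_iff row_op_def sum_distrib_left sum_subtractf right_diff_distrib mult_ac)
  show ?case by (simp add: 1 2 Suc.IH sum.distrib distrib_left)
qed simp

text \<open>All parts lie between \<open>m\<close> and \<open>c\<close>, and the columns in \<open>Z\<close> are prescribed to be zero.\<close>

definition le_fillings :: "nat \<Rightarrow> nat \<Rightarrow> nat \<Rightarrow> nat set \<Rightarrow> ((nat \<Rightarrow> nat) \<times> (nat \<times> nat) set) set" where
  "le_fillings k c m Z = {(lam, D).
     (\<forall>i. i = 0 \<or> k < i \<longrightarrow> lam i = 0) \<and>
     (\<forall>i j. 1 \<le> i \<and> i \<le> j \<and> j \<le> k \<longrightarrow> lam j \<le> lam i) \<and>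
     (\<forall>i. 1 \<le> i \<and> i \<le> k \<longrightarrow> m \<le> lam i \<and> lam i \<le> c) \<and>
     D \<subseteq> young k lam \<and> le_property (young k lam) D \<and> (\<forall>i j. (i, j) \<in> D \<longrightarrow> j \<notin> Z)}"

lemma le_diagrams_eq: "le_diagrams k n = le_fillings k (n - k) 0 {}"
proof -
  have "partition_in_box k n lam \<longleftrightarrow>
     (\<forall>i. i = 0 \<or> k < i \<longrightarrow> lam i = 0) \<and>
     (\<forall>i j. 1 \<le> i \<and> i \<le> j \<and> j \<le> k \<longrightarrow> lam j \<le> lam i) \<and>
     (\<forall>i. 1 \<le> i \<and> i \<le> k \<longrightarrow> 0 \<le> lam i \<and> lam i \<le> n - k)" for lam
  proof -
    have "(\<forall>i. lam i \<le> n - k) \<longleftrightarrow> (\<forall>i. 1 \<le> i \<and> i \<le> k \<longrightarrow> lam i \<le> n - k)"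
      if "\<forall>i. i = 0 \<or> k < i \<longrightarrow> lam i = 0"
    proof safe
      fix i assume *: "\<forall>i. 1 \<le> i \<and> i \<le> k \<longrightarrow> lam i \<le> n - k"
      show "lam i \<le> n - k"
        using that * by (cases "i = 0 \<or> k < i") (auto simp: not_less)
    qed auto
    thus ?thesis unfolding partition_in_box_def by auto
  qed
  thus ?thesis unfolding le_diagrams_def le_fillings_def by simp
qed

lemma le_fillings_0: "le_fillings 0 c m Z = {(\<lambda>_. 0, {})}"
  by (auto simp: le_fillings_def young_def le_property_def fun_eq_iff)

lemma le_fillings_empty: "c < m \<Longrightarrow> le_fillings (Suc k) c m Z = {}"
  by (force simp: le_fillings_def)

lemma finite_young: "finite (young k lam)"
proof -
  have "young k lam \<subseteq> (SIGMA i:{..k}. {..lam i})" by (auto simp: young_def)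
  thus ?thesis by (rule finite_subset) auto
qed

section \<open>Splitting off the bottom row\<close>

definition add_row :: "nat \<Rightarrow> nat \<Rightarrow> nat set \<times> (nat \<Rightarrow> nat) \<times> (nat \<times> nat) set \<Rightarrow> (nat \<Rightarrow> nat) \<times> (nat \<times> nat) set" where
  "add_row k m = (\<lambda>(R, lam, D). (lam(Suc k := m), D \<union> {Suc k} \<times> R))"

text \<open>The rows above keep \<open>m\<close> as lower bound, so that a last part equal to
  \<open>m\<close> may be appended, and they inherit the holes of the new row as prescribed zero
  columns.\<close>

definition bottom_rows :: "nat \<Rightarrow> nat \<Rightarrow> nat \<Rightarrow> nat set \<Rightarrow> (nat set \<times> (nat \<Rightarrow> nat) \<times> (nat \<times> nat) set) set" where
  "bottom_rows k c m Z = (SIGMA R:Pow ({1..m} - Z). le_fillings k c m (Z \<union> holes ({1..m} - Z) R))"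

lemma young_Suc:
  "young (Suc k) (lam(Suc k := m)) = young k lam \<union> {Suc k} \<times> {1..m}"
  by (auto simp: young_def le_Suc_eq split: if_splits)

text \<open>The new row lies below all others and puts no condition on the old boxes. Its zeros in
  \<open>Z\<close> have no 1 above them, and each other zero with a 1 to its left forces an empty
  column above; these are the holes.\<close>

lemma le_property_Suc:
  assumes D: "D \<subseteq> young k lam" and R: "R \<subseteq> {1..m} - Z" and Z: "\<forall>i j. (i, j) \<in> D \<longrightarrow> j \<notin> Z"
  shows "le_property (young k lam \<union> {Suc k} \<times> {1..m}) (D \<union> {Suc k} \<times> R) \<longleftrightarrow>
    le_property (young k lam) D \<and> (\<forall>i j. (i, j) \<in> D \<longrightarrow> j \<notin> holes ({1..m} - Z) R)"
proof -
  have k: "i \<le> k" if "(i, j) \<in> young k lam" for i j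
    using that by (simp add: young_def)
  have kD: "i \<le> k" if "(i, j) \<in> D" for i j
    using that D k by blast
  have a: "(i, j) \<in> D \<union> {Suc k} \<times> R \<longleftrightarrow> (i, j) \<in> D" if "i \<le> k" for i j
    using that by auto
  have b: "(Suc k, j) \<in> D \<union> {Suc k} \<times> R \<longleftrightarrow> j \<in> R" for j
    using kD[of "Suc k" j] by auto
  show ?thesis
  proof
    assume L: "le_property (young k lam \<union> {Suc k} \<times> {1..m}) (D \<union> {Suc k} \<times> R)"
    have "le_property (young k lam) D"
      unfolding le_property_def
    proof safe
      fix i j i' j' assume *: "(i, j) \<in> young k lam" "(i, j) \<notin> D" "i' < i" "(i', j) \<in> D" "j' < j" "(i, j') \<in> D"
      with k[of i j] have "(i, j) \<notin> D \<union> {Suc k} \<times> R" by auto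
      with * L show False unfolding le_property_def by blast
    qed
    moreover have "j \<notin> holes ({1..m} - Z) R" if ij: "(i, j) \<in> D" for i j
    proof
      assume h: "j \<in> holes ({1..m} - Z) R"
      then obtain j' where "j' \<in> R" "j' < j" "j \<in> {1..m}" "j \<notin> R" by (auto simp: holes_def)
      moreover have "i < Suc k" using kD[OF ij] by simp
      ultimately show False using L ij b[of j] unfolding le_property_def by blast
    qed
    ultimately show "le_property (young k lam) D \<and> (\<forall>i j. (i, j) \<in> D \<longrightarrow> j \<notin> holes ({1..m} - Z) R)"
      by blast
  next
    assume L: "le_property (young k lam) D \<and> (\<forall>i j. (i, j) \<in> D \<longrightarrow> j \<notin> holes ({1..m} - Z) R)"
    show "le_property (young k lam \<union> {Suc k} \<times> {1..m}) (D \<union> {Suc k} \<times> R)"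
      unfolding le_property_def
    proof (rule notI, elim exE conjE bexE)
      fix i j i' j'
      assume ij: "(i, j) \<in> young k lam \<union> {Suc k} \<times> {1..m} - (D \<union> {Suc k} \<times> R)"
        and i': "i' < i" "(i', j) \<in> D \<union> {Suc k} \<times> R" and j': "j' < j" "(i, j') \<in> D \<union> {Suc k} \<times> R"
      show False
      proof (cases "i = Suc k")
        case True
        with i' have D': "(i', j) \<in> D" using a by auto
        have "j' \<in> R" using j' True b by simp
        moreover have "j \<in> {1..m}" "j \<notin> R" using ij True k[of "Suc k" j] by auto
        moreover have "j \<notin> Z" using Z D' by blast
        ultimately have "j \<in> holes ({1..m} - Z) R" using j' by (auto simp: holes_def)
        thus False using L D' by blast
      next
        case False
        hence y: "(i, j) \<in> young k lam" "(i, j) \<notin> D" using ij by auto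
        hence "i \<le> k" by (auto dest: k)
        hence "(i, j') \<in> D" "(i', j) \<in> D" using i' j' a by auto
        thus False using L y i' j' unfolding le_property_def by blast
      qed
    qed
  qed
qed

text \<open>The parts decrease, so either the last one, and with it every part, exceeds
  \<open>m\<close>, or it equals \<open>m\<close> and its row can be removed.\<close>

lemma le_fillings_Suc:
  assumes "m \<le> c" "Z \<subseteq> {1..m}"
  shows "le_fillings (Suc k) c m Z = le_fillings (Suc k) c (Suc m) Z \<union> add_row k m ` bottom_rows k c m Z"
    (is "?L = ?A \<union> ?B")
proof
  show "?A \<union> ?B \<subseteq> ?L"
  proof
    fix x assume "x \<in> ?A \<union> ?B"
    thus "x \<in> ?L"
    proof
      assume "x \<in> ?A"
      thus ?thesis unfolding le_fillings_def by (auto dest: Suc_leD)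
    next
      assume "x \<in> ?B"
      then obtain R lam D where x: "x = (lam(Suc k := m), D \<union> {Suc k} \<times> R)"
        and R: "R \<subseteq> {1..m} - Z" and F: "(lam, D) \<in> le_fillings k c m (Z \<union> holes ({1..m} - Z) R)"
        by (auto simp: add_row_def bottom_rows_def)
      from F have D: "D \<subseteq> young k lam" and "le_property (young k lam) D"
        and DZ: "\<forall>i j. (i, j) \<in> D \<longrightarrow> j \<notin> Z" and "\<forall>i j. (i, j) \<in> D \<longrightarrow> j \<notin> holes ({1..m} - Z) R"
        by (auto simp: le_fillings_def)
      hence le: "le_property (young k lam \<union> {Suc k} \<times> {1..m}) (D \<union> {Suc k} \<times> R)"
        using le_property_Suc[OF D R DZ] by blast
      have sub: "D \<union> {Suc k} \<times> R \<subseteq> young k lam \<union> {Suc k} \<times> {1..m}"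
        using D R by blast
      have nZ: "\<forall>i j. (i, j) \<in> D \<union> {Suc k} \<times> R \<longrightarrow> j \<notin> Z"
        using DZ R by blast
      have l0: "\<forall>i. i = 0 \<or> k < i \<longrightarrow> lam i = 0"
        and l1: "\<forall>i j. 1 \<le> i \<and> i \<le> j \<and> j \<le> k \<longrightarrow> lam j \<le> lam i"
        and l2: "\<forall>i. 1 \<le> i \<and> i \<le> k \<longrightarrow> m \<le> lam i \<and> lam i \<le> c"
        using F by (auto simp: le_fillings_def)
      show ?thesis
        unfolding le_fillings_def x mem_Collect_eq prod.case young_Suc
        using le sub nZ l0 l1 l2 assms(1) by (auto simp: le_Suc_eq)
    qed
  qed
next
  show "?L \<subseteq> ?A \<union> ?B"
  proof
    fix x assume x: "x \<in> ?L"
    obtain lam D where xe: "x = (lam, D)" by (cases x)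
    from x have l0: "\<forall>i. i = 0 \<or> Suc k < i \<longrightarrow> lam i = 0"
        and l1: "\<forall>i j. 1 \<le> i \<and> i \<le> j \<and> j \<le> Suc k \<longrightarrow> lam j \<le> lam i"
        and l2: "\<forall>i. 1 \<le> i \<and> i \<le> Suc k \<longrightarrow> m \<le> lam i \<and> lam i \<le> c"
        and D: "D \<subseteq> young (Suc k) lam" and le: "le_property (young (Suc k) lam) D"
        and DZ: "\<forall>i j. (i, j) \<in> D \<longrightarrow> j \<notin> Z"
      by (auto simp: le_fillings_def xe)
    show "x \<in> ?A \<union> ?B"
    proof (cases "lam (Suc k) = m")
      case False
      hence "m < lam (Suc k)" using l2 by (simp add: order.not_eq_order_implies_strict)
      hence "Suc m \<le> lam i" if "1 \<le> i" "i \<le> Suc k" for i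
        using l1 that by (meson Suc_leI le_trans order_refl)
      hence "x \<in> ?A" using l0 l1 l2 D le DZ by (auto simp: le_fillings_def xe)
      thus ?thesis ..
    next
      case True
      \<comment> \<open>The removed part gets the value 0 that \<open>le_fillings\<close> prescribes
        beyond the last row.\<close>
      define lam' where "lam' = lam(Suc k := 0)"
      define R where "R = {j. (Suc k, j) \<in> D}"
      define D' where "D' = {(i, j) \<in> D. i \<le> k}"
      have lam: "lam = lam'(Suc k := m)" using True by (auto simp: lam'_def)
      have Y: "young (Suc k) lam = young k lam' \<union> {Suc k} \<times> {1..m}"
        unfolding lam by (rule young_Suc)
      have DD: "D = D' \<union> {Suc k} \<times> R"
        using D by (auto simp: D'_def R_def young_def le_Suc_eq)
      have D': "D' \<subseteq> young k lam'"
        using D by (auto simp: D'_def young_def lam'_def)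
      have R: "R \<subseteq> {1..m} - Z"
        using D DZ True by (auto simp: R_def young_def)
      have D'Z: "\<forall>i j. (i, j) \<in> D' \<longrightarrow> j \<notin> Z" using DZ by (auto simp: D'_def)
      have "le_property (young k lam') D' \<and> (\<forall>i j. (i, j) \<in> D' \<longrightarrow> j \<notin> holes ({1..m} - Z) R)"
        using le unfolding Y DD le_property_Suc[OF D' R D'Z] .
      moreover have "\<forall>i. i = 0 \<or> k < i \<longrightarrow> lam' i = 0"
        using l0 by (auto simp: lam'_def)
      moreover have "\<forall>i j. 1 \<le> i \<and> i \<le> j \<and> j \<le> k \<longrightarrow> lam' j \<le> lam' i"
        using l1 by (auto simp: lam'_def)
      moreover have "\<forall>i. 1 \<le> i \<and> i \<le> k \<longrightarrow> m \<le> lam' i \<and> lam' i \<le> c"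
        using l2 by (auto simp: lam'_def)
      ultimately have "(lam', D') \<in> le_fillings k c m (Z \<union> holes ({1..m} - Z) R)"
        using D' D'Z by (auto simp: le_fillings_def)
      hence "(R, lam', D') \<in> bottom_rows k c m Z" using R by (auto simp: bottom_rows_def)
      moreover have "x = add_row k m (R, lam', D')"
        unfolding xe add_row_def prod.case using lam DD by simp
      ultimately show ?thesis by blast
    qed
  qed
qed

lemma le_fillings_disjoint:
  "le_fillings (Suc k) c (Suc m) Z \<inter> add_row k m ` bottom_rows k c m Z = {}"
  by (auto simp: le_fillings_def add_row_def)

lemma bottom_rowsD:
  assumes "(R, lam, D) \<in> bottom_rows k c m Z"
  shows "lam (Suc k) = 0" "D \<subseteq> {..k} \<times> UNIV" "finite D" "finite R"
proof -
  from assms have "D \<subseteq> young k lam" and "R \<subseteq> {1..m}" and "lam (Suc k) = 0"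
    by (auto simp: bottom_rows_def le_fillings_def)
  thus "lam (Suc k) = 0" "finite D" "finite R"
    by (simp_all add: finite_subset[OF _ finite_young] finite_subset[of R "{1..m}"])
  show "D \<subseteq> {..k} \<times> UNIV"
    using \<open>D \<subseteq> young k lam\<close> by (auto simp: young_def)
qed

text \<open>The overwritten value of \<open>lam\<close> was 0 and the old boxes lie in rows up to
  \<open>k\<close>, so all three components can be recovered.\<close>

lemma inj_on_add_row: "inj_on (add_row k m) (bottom_rows k c m Z)"
proof (rule inj_onI)
  fix x x' assume x: "x \<in> bottom_rows k c m Z" "x' \<in> bottom_rows k c m Z" "add_row k m x = add_row k m x'"
  obtain R lam D where xe: "x = (R, lam, D)" by (cases x)
  obtain R' lam' D' where xe': "x' = (R', lam', D')" by (cases x')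
  have 1: "(R, lam, D) \<in> bottom_rows k c m Z" and 2: "(R', lam', D') \<in> bottom_rows k c m Z"
    and "add_row k m (R, lam, D) = add_row k m (R', lam', D')"
    using x unfolding xe xe' by blast+
  hence l: "lam(Suc k := m) = lam'(Suc k := m)" and d: "D \<union> {Suc k} \<times> R = D' \<union> {Suc k} \<times> R'"
    by (auto simp: add_row_def)
  have "lam = lam'" using l bottom_rowsD(1)[OF 1] bottom_rowsD(1)[OF 2]
    by (metis fun_upd_triv fun_upd_upd)
  moreover have "R = R'"
  proof -
    have "{j. (Suc k, j) \<in> D \<union> {Suc k} \<times> R} = R" "{j. (Suc k, j) \<in> D' \<union> {Suc k} \<times> R'} = R'"
      using bottom_rowsD(2)[OF 1] bottom_rowsD(2)[OF 2] by auto
    thus ?thesis unfolding d by simp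
  qed
  moreover have "D = D'"
  proof -
    have "(D \<union> {Suc k} \<times> R) \<inter> {..k} \<times> UNIV = D" "(D' \<union> {Suc k} \<times> R') \<inter> {..k} \<times> UNIV = D'"
      using bottom_rowsD(2)[OF 1] bottom_rowsD(2)[OF 2] by auto
    thus ?thesis unfolding d by simp
  qed
  ultimately show "x = x'" unfolding xe xe' by blast
qed

lemma card_add_row:
  assumes "(R, lam, D) \<in> bottom_rows k c m Z"
  shows "card (D \<union> {Suc k} \<times> R) = card R + card D"
proof -
  have "card (D \<union> {Suc k} \<times> R) = card D + card ({Suc k} \<times> R)"
    using bottom_rowsD[OF assms] by (intro card_Un_disjoint) auto
  thus ?thesis by (simp add: card_cartesian_product)
qed

section \<open>Weighted enumeration of the fillings\<close>

text \<open>Induction on the length \<open>k + c - m\<close> of the remaining boundary path: raising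
  the lower bound \<open>m\<close> is a column step, removing a last row of length \<open>m\<close>
  is a row step. The exponent counts the columns not prescribed to be zero.\<close>

lemma sum_le_fillings:
  fixes q :: "'a::field"
  assumes q: "q \<noteq> 0" and "m \<le> c" "Z \<subseteq> {1..m}"
  shows "finite (le_fillings k c m Z) \<and>
    (\<Sum>(lam, D)\<in>le_fillings k c m Z. q ^ card D)
      = weight q (k + c - m) k (\<lambda>j. qnum q (Suc j) ^ (m - card Z))"
  using assms(2,3)
proof (induction N \<equiv> "k + c - m" arbitrary: k m Z)
  case 0
  hence "k = 0" by simp
  thus ?case by (simp add: le_fillings_0 weight_0_right)
next
  case (Suc N)
  show ?case
  proof (cases k)
    case 0
    thus ?thesis by (simp add: le_fillings_0 weight_0_right)
  next
    case k: (Suc k')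
    have N: "Suc N = k + c - m" using Suc by simp
    let ?f = "\<lambda>j. qnum q (Suc j) ^ (m - card Z)"
    let ?w = "\<lambda>(lam, D). q ^ card (D :: (nat \<times> nat) set)"
    have finZ: "finite Z" and cZ: "card Z \<le> m"
      using Suc.prems(2) finite_subset card_mono[of "{1..m}" Z] by auto
    have A: "finite (le_fillings k c (Suc m) Z) \<and>
       (\<Sum>x\<in>le_fillings k c (Suc m) Z. ?w x) = weight q N k (col_op q ?f)"
    proof (cases "m = c")
      \<comment> \<open>Here the rows would have to be longer than \<open>c\<close>, and only
        \<open>k'\<close> steps are left for \<open>k\<close> rows, so both sides are 0.\<close>
      case True
      hence "N = k'" using N k by simp
      thus ?thesis using True k by (simp add: le_fillings_empty weight_eq_0)
    next
      case False
      hence m: "Suc m \<le> c" using Suc.prems by simp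
      have N': "N = k + c - Suc m" using N by simp
      have "Z \<subseteq> {1..Suc m}" using Suc.prems(2) by auto
      from Suc.hyps(1)[OF N' m this] show ?thesis
        using cZ unfolding N'[symmetric] by (simp add: col_op_def[abs_def] Suc_diff_le)
    qed
    let ?A = "{1..m} - Z"
    have cA: "card ?A = m - card Z" using Suc.prems(2) finZ by (simp add: card_Diff_subset)
    have B: "finite (le_fillings k' c m (Z \<union> holes ?A R)) \<and>
       (\<Sum>x\<in>le_fillings k' c m (Z \<union> holes ?A R). ?w x)
         = weight q N k' (\<lambda>j. qnum q (Suc j) ^ (card ?A - card (holes ?A R)))" for R
    proof -
      have N': "N = k' + c - m" using N k Suc.prems by simp
      have hs: "holes ?A R \<subseteq> ?A" by (auto simp: holes_def)
      have sub: "Z \<union> holes ?A R \<subseteq> {1..m}" using hs Suc.prems by blast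
      have "card (Z \<union> holes ?A R) = card Z + card (holes ?A R)"
        using hs finZ by (intro card_Un_disjoint) (auto intro: finite_subset)
      hence "m - card (Z \<union> holes ?A R) = card ?A - card (holes ?A R)" unfolding cA by simp
      thus ?thesis using Suc.hyps(1)[OF N' Suc.prems(1) sub] N' by simp
    qed
    have finB: "finite (bottom_rows k' c m Z)"
      unfolding bottom_rows_def using B by (intro finite_SigmaI) auto
    have eq: "le_fillings k c m Z = le_fillings k c (Suc m) Z \<union> add_row k' m ` bottom_rows k' c m Z"
      unfolding k by (rule le_fillings_Suc[OF Suc.prems])
    have dis: "le_fillings k c (Suc m) Z \<inter> add_row k' m ` bottom_rows k' c m Z = {}"
      unfolding k by (rule le_fillings_disjoint)
    have "(\<Sum>x\<in>add_row k' m ` bottom_rows k' c m Z. ?w x)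
        = (\<Sum>x\<in>bottom_rows k' c m Z. ?w (add_row k' m x))"
      by (subst sum.reindex[OF inj_on_add_row]) simp
    also have "\<dots> = (\<Sum>(R, x)\<in>bottom_rows k' c m Z. q ^ card R * ?w x)"
      by (rule sum.cong) (auto simp: add_row_def card_add_row power_add)
    also have "\<dots> = (\<Sum>R\<in>Pow ?A. \<Sum>x\<in>le_fillings k' c m (Z \<union> holes ?A R). q ^ card R * ?w x)"
      unfolding bottom_rows_def using B by (subst sum.Sigma) auto
    also have "\<dots> = (\<Sum>R\<in>Pow ?A. q ^ card R * weight q N k' (\<lambda>j. qnum q (Suc j) ^ (card ?A - card (holes ?A R))))"
      using B by (simp add: sum_distrib_left[symmetric])
    also have "\<dots> = weight q N k' (\<lambda>j. \<Sum>R\<in>Pow ?A. q ^ card R * qnum q (Suc j) ^ (card ?A - card (holes ?A R)))"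
      by (rule weight_sum[symmetric])
    also have "\<dots> = weight q N k' (row_op q ?f)"
      unfolding sum_holes[OF q finite_Diff[OF finite_atLeastAtMost]] unfolding cA ..
    finally have C: "(\<Sum>x\<in>add_row k' m ` bottom_rows k' c m Z. ?w x) = weight q N k' (row_op q ?f)" .
    have "(\<Sum>x\<in>le_fillings k c m Z. ?w x) = weight q (Suc N) k ?f"
      unfolding eq using A finB dis by (subst sum.union_disjoint) (auto simp: C k)
    moreover have "finite (le_fillings k c m Z)" unfolding eq using A finB by blast
    ultimately show ?thesis unfolding N by blast
  qed
qed

lemma Acoef_eq_weight:
  fixes q :: "'a::field"
  assumes "q \<noteq> 0"
  shows "Acoef q k n = weight q n k (\<lambda>_. 1)"
proof (cases "n < k")
  case False
  thus ?thesis using sum_le_fillings[OF assms, of 0 "n - k" "{}" k]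
    by (simp add: Acoef_def le_diagrams_eq)
qed (simp add: Acoef_def weight_eq_0)

section \<open>Extraction of coefficients\<close>

lemma qnum_fps_const: "qnum (fps_const q) n = fps_const (qnum q n)"
  by (induction n) (simp_all add: qnum_Suc)

lemma funpow_transfer_add:
  "(transfer q p y ^^ n) (\<lambda>j. F j + y * G j)
     = (\<lambda>j. (transfer q p y ^^ n) F j + y * (transfer q p y ^^ n) G j)"
proof (induction n)
  case (Suc n)
  show ?case by (simp add: Suc.IH fun_eq_iff) (simp add: transfer_def algebra_simps)
qed simp

lemma eigval_fps:
  "eigval (fps_const q) (fps_const p) fps_X i
     = fps_const (qnum q (Suc i)) + fps_const (- (p ^ i * qnum q i)) * fps_X"
proof -
  have "fps_const (- (p ^ i * qnum q i)) * fps_X = - (fps_X * fps_const p ^ i * fps_const (qnum q i))"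
    by (simp add: mult_ac flip: fps_const_neg)
  thus ?thesis by (simp add: eigval_def qnum_fps_const)
qed

text \<open>The variable marks row operators: \<open>transfer\<close> sends the constants given by
  \<open>f\<close> to \<open>col_op q f\<close> plus \<open>fps_X\<close> times
  \<open>row_op q f\<close>, so comparing coefficients gives the recursion of
  \<open>weight\<close>.\<close>

lemma weight_eq_transfer:
  "weight q n k f =
     (transfer (fps_const q) (fps_const (inverse q)) fps_X ^^ n) (\<lambda>j. fps_const (f j)) 0 $ k"
proof (induction n arbitrary: k f)
  case (Suc n)
  let ?T = "transfer (fps_const q) (fps_const (inverse q)) fps_X"
  have "?T (\<lambda>j. fps_const (f j)) = (\<lambda>j. fps_const (col_op q f j) + fps_X * fps_const (row_op q f j))"
  proof
    fix j
    have c: "fps_const (col_op q f j) = fps_const (qnum q (Suc j)) * fps_const (f j)"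
      by (simp add: col_op_def)
    have r: "fps_const (row_op q f j) = fps_const (inverse q) ^ j *
        (fps_const (qnum q (Suc j)) * fps_const (f (Suc j)) - fps_const (qnum q j) * fps_const (f j))"
      by (simp add: row_op_def)
    show "?T (\<lambda>j. fps_const (f j)) j = fps_const (col_op q f j) + fps_X * fps_const (row_op q f j)"
      unfolding transfer_def eigval_def qnum_fps_const c r by (simp only: algebra_simps)
  qed
  thus ?case
    by (simp add: funpow_Suc_right funpow_transfer_add Suc.IH del: funpow.simps)
qed simp

lemma fps_nth_eq_0_if_fps_X_power_dvd:
  fixes f :: "'a::comm_ring_1 fps"
  assumes "fps_X ^ m dvd f" "k < m"
  shows "f $ k = 0"
  using assms by (auto simp: fps_X_power_mult_nth)

text \<open>The binomial theorem; for r > n the binomial coefficient is 0 and the truncated exponent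
  is harmless.\<close>

lemma linear_fps_power_nth:
  fixes a b :: "'a::comm_ring_1"
  shows "(fps_const a + fps_const b * fps_X) ^ n $ r = of_nat (n choose r) * b ^ r * a ^ (n - r)"
proof (induction n arbitrary: r)
  case 0
  show ?case by (cases r) auto
next
  case (Suc n)
  have eq: "((fps_const a + fps_const b * fps_X) ^ Suc n) $ r
      = a * (fps_const a + fps_const b * fps_X) ^ n $ r
      + b * (if r = 0 then 0 else (fps_const a + fps_const b * fps_X) ^ n $ (r - 1))"
    by (simp add: distrib_right mult.assoc)
  show ?case
  proof (cases r)
    case 0
    thus ?thesis unfolding eq Suc.IH by simp
  next
    case r: (Suc r')
    show ?thesis
    proof (cases "r \<le> n")
      case True
      hence "a ^ (n - r') = a * a ^ (n - Suc r')"
        using r by (simp add: Suc_diff_Suc flip: power_Suc)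
      thus ?thesis unfolding eq Suc.IH unfolding r by (simp add: algebra_simps)
    next
      case False
      thus ?thesis unfolding eq Suc.IH unfolding r using r by (simp add: binomial_eq_0 algebra_simps)
    qed
  qed
qed

text \<open>This is the q-integer of \<open>- i\<close>.\<close>

definition qnum_neg :: "'a::field \<Rightarrow> nat \<Rightarrow> 'a" where
  "qnum_neg q i = - (inverse q ^ i * qnum q i)"

text \<open>The coefficient of y^k is exact when the eigenvector expansion is cut after i = k, since
  the error is divisible by y^(k+1). The second sum stops before \<open>k\<close> because its terms
  carry a further factor y.\<close>

lemma Acoef_expansion:
  fixes q :: "'a::field"
  assumes q: "q \<noteq> 0"
  shows "Acoef q k n =
    (\<Sum>i\<le>k. inverse q ^ i\<^sup>2 *
       (of_nat (n choose (k - i)) * qnum_neg q i ^ (k - i) * qnum q (Suc i) ^ (n - (k - i))))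
  - (\<Sum>i<k. inverse q ^ (Suc i)\<^sup>2 *
       (of_nat (n choose (k - Suc i)) * qnum_neg q i ^ (k - Suc i) * qnum q (Suc i) ^ (n - (k - Suc i))))"
proof -
  let ?q = "fps_const q" and ?p = "fps_const (inverse q)"
  let ?ev = "eigval ?q ?p fps_X"
  have pq: "?p * ?q = 1" using q by simp
  let ?S = "\<Sum>i\<le>k. eigcoef ?q ?p fps_X i 0 * ?ev i ^ n"
  have ev: "?ev i ^ n $ r = of_nat (n choose r) * qnum_neg q i ^ r * qnum q (Suc i) ^ (n - r)" for i r
    unfolding eigval_fps linear_fps_power_nth qnum_neg_def ..
  have "fps_X ^ (Suc k - 0) dvd ?S - (transfer ?q ?p fps_X ^^ n) (\<lambda>_. 1) 0"
    by (rule transfer_power_expansion[OF pq])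
  hence "(?S - (transfer ?q ?p fps_X ^^ n) (\<lambda>_. 1) 0) $ k = 0"
    by (rule fps_nth_eq_0_if_fps_X_power_dvd) simp
  hence "Acoef q k n = ?S $ k"
    by (simp add: Acoef_eq_weight[OF q] weight_eq_transfer)
  also have "\<dots> = (\<Sum>i\<le>k. (fps_X ^ i * (fps_const (inverse q ^ i\<^sup>2) * ?ev i ^ n)) $ k
     - (fps_X ^ Suc i * (fps_const (inverse q ^ (Suc i)\<^sup>2) * ?ev i ^ n)) $ k)"
    unfolding fps_sum_nth eigcoef_0[OF pq]
    by (intro sum.cong refl) (simp only: left_diff_distrib fps_sub_nth fps_const_power mult.assoc)
  also have "\<dots> = (\<Sum>i\<le>k. inverse q ^ i\<^sup>2 * ?ev i ^ n $ (k - i))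
     - (\<Sum>i\<le>k. if i < k then inverse q ^ (Suc i)\<^sup>2 * ?ev i ^ n $ (k - Suc i) else 0)"
    unfolding sum_subtractf
    by (intro arg_cong2[of _ _ _ _ "(-)"] sum.cong refl)
       (simp_all only: fps_X_power_mult_nth fps_mult_left_const_nth, auto)
  also have "(\<Sum>i\<le>k. if i < k then inverse q ^ (Suc i)\<^sup>2 * ?ev i ^ n $ (k - Suc i) else 0)
      = (\<Sum>i<k. inverse q ^ (Suc i)\<^sup>2 * ?ev i ^ n $ (k - Suc i))"
    by (rule sum.mono_neutral_cong_right) auto
  finally show ?thesis unfolding ev .
qed

section \<open>Rational generating functions\<close>

text \<open>The series x^p / (1 - a x)^(p+1). It collects over \<open>n\<close> the binomial
  coefficients and powers found in \<open>linear_fps_power_nth\<close>.\<close>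

definition pole :: "'a::field \<Rightarrow> nat \<Rightarrow> 'a fps" where
  "pole a p = Abs_fps (\<lambda>n. of_nat (n choose p) * a ^ (n - p))"

lemma one_minus_mult_pole_0: "(1 - fps_const a * fps_X) * pole a 0 = 1"
  by (rule fps_ext) (auto simp: pole_def left_diff_distrib mult.assoc simp flip: power_Suc)

text \<open>This is Pascal's rule for the ordinary binomial coefficients.\<close>

lemma one_minus_mult_pole_Suc: "(1 - fps_const a * fps_X) * pole a (Suc p) = fps_X * pole a p"
proof (rule fps_ext)
  fix n
  show "((1 - fps_const a * fps_X) * pole a (Suc p)) $ n = (fps_X * pole a p) $ n"
  proof (cases n)
    case (Suc m)
    have "a * (of_nat (m choose Suc p) * a ^ (m - Suc p)) = of_nat (m choose Suc p) * a ^ (m - p)"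
    proof (cases "Suc p \<le> m")
      case True
      hence "a ^ (m - p) = a * a ^ (m - Suc p)" by (simp add: Suc_diff_Suc flip: power_Suc)
      thus ?thesis by (simp add: mult_ac)
    qed (simp add: binomial_eq_0)
    thus ?thesis unfolding Suc by (auto simp: pole_def algebra_simps)
  qed (simp add: pole_def left_diff_distrib mult.assoc)
qed

lemma pole_eq: "pole a p = fps_X ^ p * inverse ((1 - fps_const a * fps_X) ^ (p + 1))"
proof -
  let ?f = "1 - fps_const a * fps_X"
  have M: "?f ^ Suc p * pole a p = fps_X ^ p"
  proof (induction p)
    case 0
    show ?case by (simp add: one_minus_mult_pole_0)
  next
    case (Suc p)
    have "?f ^ Suc (Suc p) * pole a (Suc p) = ?f ^ Suc p * (?f * pole a (Suc p))"
      by (simp only: power_Suc mult_ac)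
    also have "\<dots> = fps_X * (?f ^ Suc p * pole a p)"
      unfolding one_minus_mult_pole_Suc by (simp only: mult_ac)
    finally show ?case unfolding Suc.IH by simp
  qed
  have I: "inverse (?f ^ Suc p) * ?f ^ Suc p = 1"
    by (rule inverse_mult_eq_1) (simp add: fps_power_zeroth del: power_Suc)
  have "inverse (?f ^ Suc p) * fps_X ^ p = (inverse (?f ^ Suc p) * ?f ^ Suc p) * pole a p"
    unfolding M[symmetric] by (simp only: mult.assoc)
  hence "inverse (?f ^ Suc p) * fps_X ^ p = pole a p"
    unfolding I by simp
  thus ?thesis by (simp only: mult.commute Suc_eq_plus1)
qed

lemma Aser_k_expansion:
  fixes q :: "'a::field"
  assumes q: "q \<noteq> 0"
  shows "Aser_k q k =
    (\<Sum>i\<le>k. fps_const (inverse q ^ i\<^sup>2 * qnum_neg q i ^ (k - i)) * pole (qnum q (Suc i)) (k - i))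
  - (\<Sum>i<k. fps_const (inverse q ^ (Suc i)\<^sup>2 * qnum_neg q i ^ (k - Suc i)) * pole (qnum q (Suc i)) (k - Suc i))"
  by (rule fps_ext)
     (simp add: Aser_k_def Acoef_expansion[OF q] fps_sum_nth pole_def mult_ac del: fps_const_mult)

text \<open>Uniqueness is applied twice, first to the constant terms in the inner ring, then to the
  outer series, whose coefficients form no field.\<close>

lemma fps_fps_inverse_unique:
  fixes f g :: "'a::field fps fps"
  assumes "f * g = 1"
  shows "inverse f = g"
proof -
  have fg0: "f $ 0 * g $ 0 = 1" using assms by (metis fps_mult_nth_0 fps_one_nth)
  hence "inverse (f $ 0) = g $ 0" by (rule fps_inverse_unique)
  thus ?thesis
    using fps_lr_inverse_unique_ring1(2)[OF assms] fg0
    by (simp add: fps_inverse_def mult.commute)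
qed

text \<open>The inverse of 1 - a x - b x y, expanded in powers of y.\<close>

definition bipole :: "'a::field \<Rightarrow> 'a \<Rightarrow> 'a fps fps" where
  "bipole a b = Abs_fps (\<lambda>r. fps_const (b ^ r) * pole a r)"

lemma mult_bipole: "(1 - fC a * fX - fC b * fX * fY) * bipole a b = 1"
proof (rule fps_ext)
  fix n
  have "(1 - fC a * fX - fC b * fX * fY) * bipole a b =
     fps_const (1 - fps_const a * fps_X) * bipole a b - fps_const (fps_const b * fps_X) * (fY * bipole a b)"
    by (simp add: algebra_simps flip: fps_const_sub)
  hence eq: "((1 - fC a * fX - fC b * fX * fY) * bipole a b) $ n =
     (1 - fps_const a * fps_X) * bipole a b $ n - fps_const b * fps_X * (fY * bipole a b) $ n"
    by (simp only: fps_sub_nth fps_mult_left_const_nth)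
  show "((1 - fC a * fX - fC b * fX * fY) * bipole a b) $ n = 1 $ n"
  proof (cases n)
    case 0
    thus ?thesis unfolding eq by (simp add: bipole_def one_minus_mult_pole_0)
  next
    case (Suc m)
    have "(1 - fps_const a * fps_X) * bipole a b $ Suc m
        = fps_const (b ^ Suc m) * ((1 - fps_const a * fps_X) * pole a (Suc m))"
      by (simp only: bipole_def fps_nth_Abs_fps mult_ac)
    also have "fps_const (b ^ Suc m) = fps_const b * fps_const (b ^ m)" by simp
    finally have "(1 - fps_const a * fps_X) * bipole a b $ Suc m = fps_const b * fps_X * bipole a b $ m"
      unfolding one_minus_mult_pole_Suc by (simp only: bipole_def fps_nth_Abs_fps mult_ac)
    thus ?thesis unfolding eq unfolding Suc by simp
  qed
qed

section \<open>The explicit formulas\<close>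

lemma qint_of_nat: "qint q (int n) = qnum q n"
  by (simp add: qint_def qnum_def)

lemma qint_neg_of_nat: "qint q (- int n) = - (inverse q ^ n * qnum q n)"
  by (cases "n = 0") (simp_all add: qint_def qnum_def power_inverse)

lemma qint_Suc: "qint q (int n + 1) = qnum q (Suc n)"
  using qint_of_nat[of q "Suc n"] by (simp add: add.commute)

lemma inverse_power_qnum_neg:
  assumes "q \<noteq> 0"
  shows "inverse q ^ m * qnum_neg q i ^ r = (-1) ^ r * qnum q i ^ r * inverse (q ^ (m + i * r))"
  by (simp add: qnum_neg_def power_minus[of "_ * _"] power_mult_distrib power_add power_mult power_inverse mult_ac)

text \<open>After dropping the vanishing term i = 0 of the first sum in
  \<open>Acoef_expansion\<close> and shifting that sum, both sums have the same power of q and the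
  same binomial coefficient. Reversing the order of summation gives the claim.\<close>

lemma Acoef_formula_neg:
  fixes q :: "'a::field"
  assumes q: "q \<noteq> 0" and k: "k \<ge> 1"
  shows "Acoef q k n = (\<Sum>i<k. of_nat (n choose i) * inverse (q ^ ((k - i)\<^sup>2)) *
             (qint q (int i - int k) ^ i * qint q (int k - int i + 1) ^ (n - i)
              - qint q (int i - int k + 1) ^ i * qint q (int k - int i) ^ (n - i)))"
proof -
  let ?g = "\<lambda>i r. of_nat (n choose r) * qnum_neg q i ^ r * qnum q (Suc i) ^ (n - r)"
  have "(\<Sum>i\<le>k. inverse q ^ i\<^sup>2 * ?g i (k - i)) = (\<Sum>i<k. inverse q ^ (Suc i)\<^sup>2 * ?g (Suc i) (k - Suc i))"
  proof -
    have "{..k} = {..<Suc k}" by auto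
    \<comment> \<open>The assumption k >= 1 excludes 0^0 = 1 here.\<close>
    moreover have "qnum_neg q 0 ^ k = 0" using k by (simp add: qnum_neg_def)
    ultimately show ?thesis by (simp only: sum.lessThan_Suc_shift) simp
  qed
  hence "Acoef q k n = (\<Sum>i<k. inverse q ^ (Suc i)\<^sup>2 * (?g (Suc i) (k - Suc i) - ?g i (k - Suc i)))"
    unfolding Acoef_expansion[OF q] by (simp add: right_diff_distrib sum_subtractf)
  also have "\<dots> = (\<Sum>i<k. inverse q ^ (Suc (k - Suc i))\<^sup>2 *
       (?g (Suc (k - Suc i)) (k - Suc (k - Suc i)) - ?g (k - Suc i) (k - Suc (k - Suc i))))"
    by (rule sum.nat_diff_reindex[symmetric])
  also have "\<dots> = (\<Sum>i<k. of_nat (n choose i) * inverse (q ^ ((k - i)\<^sup>2)) *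
             (qint q (int i - int k) ^ i * qint q (int k - int i + 1) ^ (n - i)
              - qint q (int i - int k + 1) ^ i * qint q (int k - int i) ^ (n - i)))"
  proof (rule sum.cong[OF refl])
    fix i assume "i \<in> {..<k}"
    hence i: "i < k" by simp
    have 1: "Suc (k - Suc i) = k - i" "k - Suc (k - Suc i) = i" "k - (k - i) = i" using i by auto
    have "int i - int k = - int (k - i)" "int k - int i = int (k - i)"
      "int i - int k + 1 = - int (k - Suc i)" using i by auto
    hence 2: "qint q (int i - int k) = qnum_neg q (k - i)" "qint q (int k - int i + 1) = qnum q (Suc (k - i))"
      "qint q (int i - int k + 1) = qnum_neg q (k - Suc i)" "qint q (int k - int i) = qnum q (k - i)"
      by (simp_all only: qint_neg_of_nat qint_of_nat qint_Suc qnum_neg_def)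
    show "inverse q ^ (Suc (k - Suc i))\<^sup>2 *
       (?g (Suc (k - Suc i)) (k - Suc (k - Suc i)) - ?g (k - Suc i) (k - Suc (k - Suc i)))
      = of_nat (n choose i) * inverse (q ^ ((k - i)\<^sup>2)) *
             (qint q (int i - int k) ^ i * qint q (int k - int i + 1) ^ (n - i)
              - qint q (int i - int k + 1) ^ i * qint q (int k - int i) ^ (n - i))"
      unfolding 1 2 power_inverse by (simp only: right_diff_distrib mult_ac)
  qed
  finally show ?thesis .
qed

text \<open>Termwise from the other form by [-m] = -q^(-m) [m]; the powers of q match because
  (k-i)^2 + (k-i) i + k i and (k-i)^2 + (k-i-1) i + (k+1) i are both k^2.\<close>

lemma Acoef_formula_pos:
  fixes q :: "'a::field"
  assumes q: "q \<noteq> 0" and k: "k \<ge> 1"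
  shows "Acoef q k n = inverse (q ^ (k ^ 2)) *
          (\<Sum>i<k. (-1) ^ i * of_nat (n choose i) *
             (q ^ (k * i) * qint q (int k - int i) ^ i * qint q (int k - int i + 1) ^ (n - i)
              - q ^ ((k + 1) * i) * qint q (int k - int i - 1) ^ i * qint q (int k - int i) ^ (n - i)))"
  unfolding Acoef_formula_neg[OF assms] sum_distrib_left
proof (rule sum.cong[OF refl])
  fix i assume "i \<in> {..<k}"
  hence i: "i < k" by simp
  define a where "a = qint q (int k - int i)"
  define a1 where "a1 = qint q (int k - int i + 1)"
  define a0 where "a0 = qint q (int k - int i - 1)"
  have ints: "int i - int k = - int (k - i)" "int k - int i = int (k - i)"
    "int i - int k + 1 = - int (k - Suc i)" "int k - int i - 1 = int (k - Suc i)" using i by auto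
  have neg: "(- (inverse q ^ m * x)) ^ i = inverse q ^ (m * i) * ((-1) ^ i * x ^ i)" for m x
    by (simp add: power_minus[of "_ * _"] power_mult_distrib mult_ac flip: power_mult)
  have inv: "inverse q ^ m = q ^ r * inverse (q ^ s)" if "m + r = s" for m r s
    using q by (simp add: that[symmetric] power_add power_inverse field_simps)
  have "inverse (q ^ (k - i)\<^sup>2) * qint q (int i - int k) ^ i
      = inverse q ^ ((k - i)\<^sup>2 + (k - i) * i) * ((-1) ^ i * a ^ i)"
    unfolding a_def ints(1,2) qint_neg_of_nat qint_of_nat neg power_add by (simp only: power_inverse mult_ac)
  also have "inverse q ^ ((k - i)\<^sup>2 + (k - i) * i) = q ^ (k * i) * inverse (q ^ k\<^sup>2)"
  proof (rule inv)
    obtain d where "k = i + d" using i less_imp_add_positive by blast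
    thus "(k - i)\<^sup>2 + (k - i) * i + k * i = k\<^sup>2" by (simp add: power2_eq_square algebra_simps)
  qed
  finally have 1: "inverse (q ^ (k - i)\<^sup>2) * qint q (int i - int k) ^ i
      = q ^ (k * i) * inverse (q ^ k\<^sup>2) * ((-1) ^ i * a ^ i)" .
  have "inverse (q ^ (k - i)\<^sup>2) * qint q (int i - int k + 1) ^ i
      = inverse q ^ ((k - i)\<^sup>2 + (k - Suc i) * i) * ((-1) ^ i * a0 ^ i)"
    unfolding a0_def ints(3,4) qint_neg_of_nat qint_of_nat neg power_add by (simp only: power_inverse mult_ac)
  also have "inverse q ^ ((k - i)\<^sup>2 + (k - Suc i) * i) = q ^ ((k + 1) * i) * inverse (q ^ k\<^sup>2)"
  proof (rule inv)
    obtain d where "k = Suc (i + d)" using i less_imp_Suc_add by blast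
    thus "(k - i)\<^sup>2 + (k - Suc i) * i + (k + 1) * i = k\<^sup>2" by (simp add: power2_eq_square algebra_simps)
  qed
  finally have 2: "inverse (q ^ (k - i)\<^sup>2) * qint q (int i - int k + 1) ^ i
      = q ^ ((k + 1) * i) * inverse (q ^ k\<^sup>2) * ((-1) ^ i * a0 ^ i)" .
  have "of_nat (n choose i) * inverse (q ^ (k - i)\<^sup>2) *
      (qint q (int i - int k) ^ i * a1 ^ (n - i) - qint q (int i - int k + 1) ^ i * a ^ (n - i))
    = of_nat (n choose i) * ((inverse (q ^ (k - i)\<^sup>2) * qint q (int i - int k) ^ i) * a1 ^ (n - i)
       - (inverse (q ^ (k - i)\<^sup>2) * qint q (int i - int k + 1) ^ i) * a ^ (n - i))"
    by (simp only: right_diff_distrib mult_ac)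
  also have "\<dots> = inverse (q ^ k\<^sup>2) * ((-1) ^ i * of_nat (n choose i) *
      (q ^ (k * i) * a ^ i * a1 ^ (n - i) - q ^ ((k + 1) * i) * a0 ^ i * a ^ (n - i)))"
    unfolding 1 2 by (simp only: right_diff_distrib mult_ac)
  finally show "of_nat (n choose i) * inverse (q ^ (k - i)\<^sup>2) *
      (qint q (int i - int k) ^ i * qint q (int k - int i + 1) ^ (n - i)
        - qint q (int i - int k + 1) ^ i * qint q (int k - int i) ^ (n - i))
    = inverse (q ^ k\<^sup>2) * ((-1) ^ i * of_nat (n choose i) *
      (q ^ (k * i) * qint q (int k - int i) ^ i * qint q (int k - int i + 1) ^ (n - i)
       - q ^ ((k + 1) * i) * qint q (int k - int i - 1) ^ i * qint q (int k - int i) ^ (n - i)))"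
    unfolding a_def a0_def a1_def .
qed

text \<open>The sums are those of \<open>Aser_k_expansion\<close>, term by term and in swapped
  order. In the sum over i < k the sign (-1)^(k-i-1) absorbs the minus in front.\<close>

lemma Aser_k_formula:
  fixes q :: "'a::field"
  assumes q: "q \<noteq> 0"
  shows "Aser_k q k =
          (\<Sum>i<k. fps_const ((-1) ^ (i + k) * qint q (int i) ^ (k - i - 1) * inverse (q ^ (k * i + i + 1)))
                 * fps_X ^ (k - i - 1) * inverse ((1 - fps_const (qint q (int i + 1)) * fps_X) ^ (k - i)))
        + (\<Sum>i\<le>k. fps_const ((-1) ^ (i + k) * qint q (int i) ^ (k - i) * inverse (q ^ (k * i)))
                 * fps_X ^ (k - i) * inverse ((1 - fps_const (qint q (int i + 1)) * fps_X) ^ (k - i + 1)))"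
proof -
  have A: "fps_const (inverse q ^ i\<^sup>2 * qnum_neg q i ^ (k - i)) * pole (qnum q (Suc i)) (k - i)
     = fps_const ((-1) ^ (i + k) * qint q (int i) ^ (k - i) * inverse (q ^ (k * i)))
                 * fps_X ^ (k - i) * inverse ((1 - fps_const (qint q (int i + 1)) * fps_X) ^ (k - i + 1))"
    if i: "i \<le> k" for i
  proof -
    obtain d where d: "k = i + d" using i le_Suc_ex by blast
    have e: "i\<^sup>2 + i * (k - i) = k * i" using d by (simp add: power2_eq_square algebra_simps)
    have s: "(-1) ^ (k - i) = ((-1) ^ (i + k) :: 'a)" using d by (simp add: power_add)
    show ?thesis
      unfolding inverse_power_qnum_neg[OF q] pole_eq qint_Suc qint_of_nat e s by (simp only: mult.assoc)
  qed
  have B: "fps_const (inverse q ^ (Suc i)\<^sup>2 * qnum_neg q i ^ (k - Suc i)) * pole (qnum q (Suc i)) (k - Suc i)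
     = - (fps_const ((-1) ^ (i + k) * qint q (int i) ^ (k - i - 1) * inverse (q ^ (k * i + i + 1)))
                 * fps_X ^ (k - i - 1) * inverse ((1 - fps_const (qint q (int i + 1)) * fps_X) ^ (k - i)))"
    if i: "i < k" for i
  proof -
    obtain d where d: "k = Suc (i + d)" using i less_imp_Suc_add by blast
    have e: "(Suc i)\<^sup>2 + i * (k - Suc i) = k * i + i + 1" using d by (simp add: power2_eq_square algebra_simps)
    have s: "(-1) ^ (k - Suc i) = (- ((-1) ^ (i + k)) :: 'a)" using d by (simp add: power_add)
    have m: "k - i - 1 = k - Suc i" "k - Suc i + 1 = k - i" using i by auto
    show ?thesis
      unfolding inverse_power_qnum_neg[OF q] pole_eq qint_Suc qint_of_nat e s m
      by (simp only: mult_minus_left fps_const_neg[symmetric] mult.assoc)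
  qed
  have "(\<Sum>i\<le>k. fps_const (inverse q ^ i\<^sup>2 * qnum_neg q i ^ (k - i)) * pole (qnum q (Suc i)) (k - i))
     = (\<Sum>i\<le>k. fps_const ((-1) ^ (i + k) * qint q (int i) ^ (k - i) * inverse (q ^ (k * i)))
                 * fps_X ^ (k - i) * inverse ((1 - fps_const (qint q (int i + 1)) * fps_X) ^ (k - i + 1)))"
    by (intro sum.cong refl A) simp
  moreover have "(\<Sum>i<k. fps_const (inverse q ^ (Suc i)\<^sup>2 * qnum_neg q i ^ (k - Suc i)) * pole (qnum q (Suc i)) (k - Suc i))
     = (\<Sum>i<k. - (fps_const ((-1) ^ (i + k) * qint q (int i) ^ (k - i - 1) * inverse (q ^ (k * i + i + 1)))
                 * fps_X ^ (k - i - 1) * inverse ((1 - fps_const (qint q (int i + 1)) * fps_X) ^ (k - i))))"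
    by (intro sum.cong refl B) simp
  ultimately show ?thesis
    unfolding Aser_k_expansion[OF q] by (simp only: sum_negf diff_minus_eq_add add.commute)
qed

section \<open>The bivariate series\<close>

text \<open>The contribution of eigenvector \<open>i\<close>: \<open>eigcoef\<close> at 0 times the
  geometric series of \<open>eigval\<close> times x.\<close>

definition eigterm :: "'a::field \<Rightarrow> nat \<Rightarrow> 'a fps fps" where
  "eigterm q i = fY ^ i * (fC (inverse q ^ i\<^sup>2) * bipole (qnum q (Suc i)) (qnum_neg q i))
     - fY ^ Suc i * (fC (inverse q ^ (Suc i)\<^sup>2) * bipole (qnum q (Suc i)) (qnum_neg q i))"

lemma eigterm_nth:
  "eigterm q i $ k =
    (if i \<le> k then fps_const (inverse q ^ i\<^sup>2 * qnum_neg q i ^ (k - i)) * pole (qnum q (Suc i)) (k - i) else 0)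
  - (if i < k then fps_const (inverse q ^ (Suc i)\<^sup>2 * qnum_neg q i ^ (k - Suc i)) * pole (qnum q (Suc i)) (k - Suc i) else 0)"
  unfolding eigterm_def fps_sub_nth fps_X_power_mult_nth fps_mult_left_const_nth bipole_def fps_nth_Abs_fps
  by (auto simp: mult.assoc simp flip: fps_const_mult)

text \<open>Every \<open>eigterm q i\<close> is divisible by y^i, so nothing beyond i = k reaches
  the coefficient of y^k.\<close>

lemma sum_eigterm_nth:
  fixes q :: "'a::field"
  assumes q: "q \<noteq> 0" and "k < m"
  shows "(\<Sum>i<m. eigterm q i) $ k = Aser_k q k"
proof -
  have "(\<Sum>i<m. eigterm q i) $ k =
    (\<Sum>i<m. if i \<le> k then fps_const (inverse q ^ i\<^sup>2 * qnum_neg q i ^ (k - i)) * pole (qnum q (Suc i)) (k - i) else 0)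
  - (\<Sum>i<m. if i < k then fps_const (inverse q ^ (Suc i)\<^sup>2 * qnum_neg q i ^ (k - Suc i)) * pole (qnum q (Suc i)) (k - Suc i) else 0)"
    unfolding fps_sum_nth eigterm_nth sum_subtractf ..
  also have "\<dots> = Aser_k q k"
    unfolding Aser_k_expansion[OF q]
    by (intro arg_cong2[of _ _ _ _ "(-)"] sum.mono_neutral_cong_right) (use \<open>k < m\<close> in auto)
  finally show ?thesis .
qed

text \<open>Each coefficient of the partial sums is eventually constant, which is convergence of
  formal power series. The term i = 0 is set apart because the claimed series starts at i =
  1.\<close>

lemma eigterm_sums:
  fixes q :: "'a::field"
  assumes q: "q \<noteq> 0"
  shows "(\<lambda>i. eigterm q (Suc i)) sums (Abs_fps (Aser_k q) - eigterm q 0)"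
  unfolding sums_def
proof (rule tendsto_fpsI)
  fix k
  have "(\<Sum>i<m. eigterm q (Suc i)) $ k = (Abs_fps (Aser_k q) - eigterm q 0) $ k" if "k \<le> m" for m
  proof -
    have "(\<Sum>i<Suc m. eigterm q i) $ k = Aser_k q k"
      using that by (intro sum_eigterm_nth[OF q]) simp
    thus ?thesis unfolding sum.lessThan_Suc_shift by (simp add: algebra_simps)
  qed
  thus "\<forall>\<^sub>F m in sequentially. (\<Sum>i<m. eigterm q (Suc i)) $ k = (Abs_fps (Aser_k q) - eigterm q 0) $ k"
    unfolding eventually_sequentially by blast
qed

text \<open>By [i] = -q^i [-i] the denominator is q^i (1 - [i+1] x - [-i] x y), whose second factor
  is inverted by \<open>bipole\<close>.\<close>

lemma inverse_denominator:
  fixes q :: "'a::field"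
  assumes q: "q \<noteq> 0"
  shows "inverse (fC (q ^ i) - fC (q ^ i * qint q (int i + 1)) * fX + fC (qint q (int i)) * fX * fY)
    = fC (inverse q ^ i) * bipole (qnum q (Suc i)) (qnum_neg q i)"
proof (rule fps_fps_inverse_unique)
  let ?a = "qnum q (Suc i)" and ?b = "qnum_neg q i"
  have factor: "A - A * B * x + (- (A * C)) * x * y = A * (1 - B * x - C * x * y)"
    for A B C x y :: "'a fps fps"
    by (simp add: algebra_simps)
  have qi: "fC (q ^ i) * fC (inverse q ^ i) = 1"
    using q by (simp add: power_inverse)
  have "qnum q i = - (q ^ i * ?b)" using q by (simp add: qnum_neg_def power_inverse)
  hence "fC (qnum q i) = - (fC (q ^ i) * fC ?b)" by simp
  hence "fC (q ^ i) - fC (q ^ i * qint q (int i + 1)) * fX + fC (qint q (int i)) * fX * fY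
     = fC (q ^ i) - fC (q ^ i) * fC ?a * fX + (- (fC (q ^ i) * fC ?b)) * fX * fY"
    unfolding qint_Suc qint_of_nat by simp
  also have "\<dots> = fC (q ^ i) * (1 - fC ?a * fX - fC ?b * fX * fY)"
    by (rule factor)
  finally have "(fC (q ^ i) - fC (q ^ i * qint q (int i + 1)) * fX + fC (qint q (int i)) * fX * fY)
      * (fC (inverse q ^ i) * bipole ?a ?b)
    = (fC (q ^ i) * fC (inverse q ^ i)) * ((1 - fC ?a * fX - fC ?b * fX * fY) * bipole ?a ?b)"
    by (simp only: mult_ac)
  thus "(fC (q ^ i) - fC (q ^ i * qint q (int i + 1)) * fX + fC (qint q (int i)) * fX * fY)
      * (fC (inverse q ^ i) * bipole ?a ?b) = 1"
    unfolding qi mult_bipole by simp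
qed

lemma eigterm_eq:
  fixes q :: "'a::field"
  assumes q: "q \<noteq> 0"
  shows "fY ^ i * (fC (q ^ (2 * i + 1)) - fY) * fC (inverse (q ^ (i\<^sup>2 + i + 1)))
     * inverse (fC (q ^ i) - fC (q ^ i * qint q (int i + 1)) * fX + fC (qint q (int i)) * fX * fY) = eigterm q i"
proof -
  let ?R = "bipole (qnum q (Suc i)) (qnum_neg q i)"
  have e: "2 * i + 1 = i + i + 1" by simp
  have "q ^ (2 * i + 1) * (inverse (q ^ (i\<^sup>2 + i + 1)) * inverse q ^ i) = inverse q ^ i\<^sup>2"
    unfolding e power_add using q by (simp add: field_simps)
  hence 1: "fC (q ^ (2 * i + 1)) * (fC (inverse (q ^ (i\<^sup>2 + i + 1))) * fC (inverse q ^ i)) = fC (inverse q ^ i\<^sup>2)"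
    by simp
  have "(Suc i)\<^sup>2 = i\<^sup>2 + i + 1 + i" by (simp add: power2_eq_square)
  hence "inverse (q ^ (i\<^sup>2 + i + 1)) * inverse q ^ i = inverse q ^ (Suc i)\<^sup>2"
    by (simp only: power_add[of _ "i\<^sup>2 + i + 1" i] power_inverse)
  hence 2: "fC (inverse (q ^ (i\<^sup>2 + i + 1))) * fC (inverse q ^ i) = fC (inverse q ^ (Suc i)\<^sup>2)"
    by simp
  have "fY ^ i * (fC (q ^ (2 * i + 1)) - fY) * fC (inverse (q ^ (i\<^sup>2 + i + 1))) * (fC (inverse q ^ i) * ?R)
     = fY ^ i * ((fC (q ^ (2 * i + 1)) * (fC (inverse (q ^ (i\<^sup>2 + i + 1))) * fC (inverse q ^ i))) * ?R)
      - fY ^ Suc i * ((fC (inverse (q ^ (i\<^sup>2 + i + 1))) * fC (inverse q ^ i)) * ?R)"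
    by (simp only: right_diff_distrib left_diff_distrib mult_ac power_Suc)
  thus ?thesis unfolding inverse_denominator[OF q] eigterm_def 1 unfolding 2 .
qed

text \<open>The term i = 0 is 1/(1-x) - y/(q (1-x)). Its first part is the row k = 0, which
  \<open>Aser\<close> leaves out, and its second part is the separate summand of the
  formula.\<close>

lemma Aser_formula:
  fixes q :: "'a::field"
  assumes q: "q \<noteq> 0"
  shows "Aser q =
      - fY * fC (inverse q) * inverse (1 - fX)
      + (\<Sum>i. fY ^ Suc i * (fC (q ^ (2 * Suc i + 1)) - fY) * fC (inverse (q ^ (Suc i ^ 2 + Suc i + 1)))
               * inverse (fC (q ^ Suc i) - fC (q ^ Suc i * qint q (int (Suc i) + 1)) * fX
                          + fC (qint q (int (Suc i))) * fX * fY))"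
proof -
  have "(1 - fX) * bipole 1 0 = (1 :: 'a fps fps)"
    using mult_bipole[of "1::'a" 0] by simp
  hence R0: "inverse (1 - fX) = (bipole 1 0 :: 'a fps fps)"
    by (rule fps_fps_inverse_unique)
  have "eigterm q 0 = bipole 1 0 - fY * fC (inverse q) * inverse (1 - fX)"
    unfolding R0 by (simp add: eigterm_def qnum_neg_def mult.assoc)
  moreover have "Abs_fps (Aser_k q) = Aser q + bipole 1 0"
  proof (rule fps_ext)
    fix k
    show "Abs_fps (Aser_k q) $ k = (Aser q + bipole 1 0) $ k"
      by (cases k) (simp_all add: Aser_def bipole_def Aser_k_expansion[OF q])
  qed
  moreover have "(\<Sum>i. eigterm q (Suc i)) = Abs_fps (Aser_k q) - eigterm q 0"
    using eigterm_sums[OF q] by (rule sums_unique[symmetric])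
  ultimately show ?thesis unfolding eigterm_eq[OF q] by simp
qed

theorem mainTheorem1:
  fixes q :: "'a::field"
  assumes "q \<noteq> 0"
  shows
   "Aser q =
      - fY * fC (inverse q) * inverse (1 - fX)
      + (\<Sum>i. fY ^ Suc i * (fC (q ^ (2 * Suc i + 1)) - fY) * fC (inverse (q ^ (Suc i ^ 2 + Suc i + 1)))
               * inverse (fC (q ^ Suc i) - fC (q ^ Suc i * qint q (int (Suc i) + 1)) * fX
                          + fC (qint q (int (Suc i))) * fX * fY))
    \<and> (\<forall>k\<ge>1. Aser_k q k =
          (\<Sum>i<k. fps_const ((-1) ^ (i + k) * qint q (int i) ^ (k - i - 1) * inverse (q ^ (k * i + i + 1)))
                 * fps_X ^ (k - i - 1) * inverse ((1 - fps_const (qint q (int i + 1)) * fps_X) ^ (k - i)))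
        + (\<Sum>i\<le>k. fps_const ((-1) ^ (i + k) * qint q (int i) ^ (k - i) * inverse (q ^ (k * i)))
                 * fps_X ^ (k - i) * inverse ((1 - fps_const (qint q (int i + 1)) * fps_X) ^ (k - i + 1))))
    \<and> (\<forall>k\<ge>1. \<forall>n. Acoef q k n =
          inverse (q ^ (k ^ 2)) *
          (\<Sum>i<k. (-1) ^ i * of_nat (n choose i) *
             (q ^ (k * i) * qint q (int k - int i) ^ i * qint q (int k - int i + 1) ^ (n - i)
              - q ^ ((k + 1) * i) * qint q (int k - int i - 1) ^ i * qint q (int k - int i) ^ (n - i)))
        \<and> Acoef q k n =
          (\<Sum>i<k. of_nat (n choose i) * inverse (q ^ ((k - i) ^ 2)) *
             (qint q (int i - int k) ^ i * qint q (int k - int i + 1) ^ (n - i)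
              - qint q (int i - int k + 1) ^ i * qint q (int k - int i) ^ (n - i))))"
  using Aser_formula[OF assms] Aser_k_formula[OF assms] Acoef_formula_pos[OF assms]
    Acoef_formula_neg[OF assms]
  by blast

end
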